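(* Let $\mathcal T=(\mathbb T,\mathcal V,\xi)$ be a topological theory with $\bot\neq k$ in $\mathcal V$ and $T1=1$. The Kleisli category $\mathcal T\text{-}\mathsf{ReprCat}_{\mathbb V}$ of the monad $\mathbb V=(V,\mathsf h,\mathsf w)$ on $\mathcal T\text{-}\mathsf{ReprCat}$ is equivalent to $\mathcal T\text{-}\mathsf{ReprDist}$.
   Context: **Theory.** A topological theory $\mathcal T=(\mathbb T,\mathcal V,\xi)$ consists of a monad $\mathbb T=(T,e,m)$ on $\mathsf{Set}$, a commutative unital quantale $\mathcal V=(\mathcal V,\otimes,k)$ (complete lattice, commutative monoid, $\otimes$ preserves suprema in each variable; $x\otimes y\le z\iff x\le\hom(y,z)$) and a map $\xi:T\mathcal V\to\mathcal V$ such that (a) $T$ preserves weak pullbacks and every naturality square of $m$ is a weak pullback; (b) $(\mathcal V,\xi)$ is an Eilenberg–Moore $\mathbb T$-algebra, $\xi\cdot T(\otimes)=\otimes\cdot\langle\xi\cdot T\pi_1,\xi\cdot T\pi_2\rangle$ on $T(\mathcal V\times\mathcal V)$, and $\xi\cdot T(k)$ is constant $k$ on $T1$ (with $k:1\to\mathcal V$); (c) for every map $f:X\to Y$ and $\varphi:X\to\mathcal V$, $\xi\cdot T(f_!\varphi)=(Tf)_!(\xi\cdot T\varphi)$, where $f_!\varphi(y)=\bigvee_{f(x)=y}\varphi(x)$. **Relations.** A $\mathcal V$-relation $r:X\nrightarrow Y$ is a map $X\times Y\to\mathcal V$, ordered pointwise; $(s\cdot r)(x,z)=\bigvee_y r(x,y)\otimes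 s(y,z)$; $r^\circ(y,x)=r(x,y)$; a map $f$ is identified with the relation with value $k$ if $f(x)=y$ and $\bot$ otherwise. $T_\xi r:TX\nrightarrow TY$ is $T_\xi r(\mathfrak x,\mathfrak y)=\bigvee\{\xi\cdot Tr(\mathfrak w)\mid \mathfrak w\in T(X\times Y),T\pi_1(\mathfrak w)=\mathfrak x,T\pi_2(\mathfrak w)=\mathfrak y\}$. **$\mathcal T$-categories.** A $\mathcal T$-category is $(X,a)$ with $a:TX\nrightarrow X$, $e_X^\circ\le a$ and $a\cdot T_\xi a\cdot m_X^\circ\le a$; a $\mathcal T$-functor $f:(X,a)\to(Y,b)$ is a map with $a(\mathfrak x,x)\le b(Tf(\mathfrak x),f(x))$. They form $\mathcal T\text{-}\mathsf{Cat}$. $a_0=a\cdot e_X$. For maps into $(Y,b)$: $f\le g$ iff $k\le b_0(f(x),g(x))$ for all $x$; $f\simeq g$ iff $f\le g$ and $g\le f$; $f\dashv g$ means $1\le gf$ and $fg\le 1$. **Representable.** $TX$ carries the $\mathcal T$-category structure $T_\xi a\cdot m_X^\circ\cdot m_X$; $X$ is representable if $e_X:X\to TX$ has a left adjoint $\alpha:TX\to X$ in $\mathcal T\text{-}\mathsf{Cat}$. A $\mathcal T$-functor $f$ between representable $\mathcal T$-categories (with left adjoints $\alpha,\beta$) is a pseudo-homomorphism if $\beta\cdot Tf\simeq f\cdot\alpha$. $\mathcal T\text{-}\mathsf{ReprCat}$: representable $\mathcal T$-categories and pseudo-homomorphisms. **$\mathcal T\text{-}\mathsf{ReprDist}$.**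 Objects are representable $\mathcal T$-categories; a morphism $(X,a)\to(Y,b)$ is a $\mathcal V$-relation $\psi:X\nrightarrow Y$ with $\psi\cdot a_0\le\psi$, $b_0\cdot\psi\le\psi$ (a $\mathcal V$-distributor) and $\psi\cdot a=b\cdot T_\xi\psi$. Composition is that of $\mathcal V$-relations; the identity on $(X,a)$ is $a_0$. **The monad $\mathbb V$.** $\mathcal V$ is a $\mathcal T$-category with structure $(\mathfrak v,v)\mapsto\hom(\xi(\mathfrak v),v)$. $\mathcal V^X$ is the set of $\mathcal T$-functors $\varphi:X\to\mathcal V$; $\mathrm{ev}:\mathcal V^X\nrightarrow X$, $\mathrm{ev}(\varphi,x)=\varphi(x)$; $\mu=a\cdot T_\xi\mathrm{ev}$. $VX$ is the $\mathcal T$-category on the set $\mathcal V^X$ with structure $(\mathfrak p,\varphi)\mapsto\bigwedge_{x}\hom(\varphi(x),\mu(\mathfrak p,x))$; it is representable if $X$ is. For $f:(X,a)\to(Y,b)$, $Vf(\varphi)(y)=\bigvee_{\mathfrak x\in TX}\xi(T\varphi(\mathfrak x))\otimes b(Tf(\mathfrak x),y)$. Unit: $\mathsf h_X(x)=a_0(x,-)$; multiplication: $\mathsf w_X:VVX\to VX$, $\mathsf w_X(\Phi)(x)=\Phi(\mathsf h_X(x))$. This is a monad on $\mathcal T\text{-}\mathsf{ReprCat}$. *)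

theory Defs
  imports Main "HOL-Library.FuncSet"
begin

section \<open>Categories, equivalence, Kleisli categories\<close>

text \<open>
  Categories are given by families of hom-sets, which need not be disjoint; therefore
  composition takes the three objects involved:
  \<open>Comp C X Y Z g f\<close> is \<open>g \<circ> f : X \<rightarrow> Y \<rightarrow> Z\<close>.
\<close>

record ('o, 'm) cat =
  Obj :: "'o set"
  Hom :: "'o \<Rightarrow> 'o \<Rightarrow> 'm set"
  Ident :: "'o \<Rightarrow> 'm"
  Comp :: "'o \<Rightarrow> 'o \<Rightarrow> 'o \<Rightarrow> 'm \<Rightarrow> 'm \<Rightarrow> 'm"

definition category :: "('o, 'm) cat \<Rightarrow> bool" where
  "category C \<longleftrightarrow>
     (\<forall>X\<in>Obj C. Ident C X \<in> Hom C X X) \<and>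
     (\<forall>X\<in>Obj C. \<forall>Y\<in>Obj C. \<forall>Z\<in>Obj C. \<forall>f\<in>Hom C X Y. \<forall>g\<in>Hom C Y Z.
        Comp C X Y Z g f \<in> Hom C X Z) \<and>
     (\<forall>X\<in>Obj C. \<forall>Y\<in>Obj C. \<forall>f\<in>Hom C X Y.
        Comp C X X Y f (Ident C X) = f \<and> Comp C X Y Y (Ident C Y) f = f) \<and>
     (\<forall>W\<in>Obj C. \<forall>X\<in>Obj C. \<forall>Y\<in>Obj C. \<forall>Z\<in>Obj C.
        \<forall>f\<in>Hom C W X. \<forall>g\<in>Hom C X Y. \<forall>h\<in>Hom C Y Z.
        Comp C W Y Z h (Comp C W X Y g f) = Comp C W X Z (Comp C X Y Z h g) f)"

definition is_functor ::
  "('o, 'm) cat \<Rightarrow> ('p, 'n) cat \<Rightarrow> ('o \<Rightarrow> 'p) \<Rightarrow> ('o \<Rightarrow> 'o \<Rightarrow> 'm \<Rightarrow> 'n) \<Rightarrow> bool" where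
  "is_functor C D Fo Fm \<longleftrightarrow>
     (\<forall>X\<in>Obj C. Fo X \<in> Obj D) \<and>
     (\<forall>X\<in>Obj C. \<forall>Y\<in>Obj C. \<forall>f\<in>Hom C X Y. Fm X Y f \<in> Hom D (Fo X) (Fo Y)) \<and>
     (\<forall>X\<in>Obj C. Fm X X (Ident C X) = Ident D (Fo X)) \<and>
     (\<forall>X\<in>Obj C. \<forall>Y\<in>Obj C. \<forall>Z\<in>Obj C. \<forall>f\<in>Hom C X Y. \<forall>g\<in>Hom C Y Z.
        Fm X Z (Comp C X Y Z g f) = Comp D (Fo X) (Fo Y) (Fo Z) (Fm Y Z g) (Fm X Y f))"

definition is_iso :: "('o, 'm) cat \<Rightarrow> 'o \<Rightarrow> 'o \<Rightarrow> 'm \<Rightarrow> bool" where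
  "is_iso C X Y f \<longleftrightarrow> f \<in> Hom C X Y \<and>
     (\<exists>g\<in>Hom C Y X. Comp C X Y X g f = Ident C X \<and> Comp C Y X Y f g = Ident C Y)"

definition natural_iso ::
  "('o, 'm) cat \<Rightarrow> ('p, 'n) cat \<Rightarrow> ('o \<Rightarrow> 'p) \<Rightarrow> ('o \<Rightarrow> 'o \<Rightarrow> 'm \<Rightarrow> 'n)
     \<Rightarrow> ('o \<Rightarrow> 'p) \<Rightarrow> ('o \<Rightarrow> 'o \<Rightarrow> 'm \<Rightarrow> 'n) \<Rightarrow> ('o \<Rightarrow> 'n) \<Rightarrow> bool" where
  "natural_iso C D Fo Fm Go Gm \<eta> \<longleftrightarrow>
     (\<forall>X\<in>Obj C. is_iso D (Fo X) (Go X) (\<eta> X)) \<and>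
     (\<forall>X\<in>Obj C. \<forall>Y\<in>Obj C. \<forall>f\<in>Hom C X Y.
        Comp D (Fo X) (Fo Y) (Go Y) (\<eta> Y) (Fm X Y f)
        = Comp D (Fo X) (Go X) (Go Y) (Gm X Y f) (\<eta> X))"

definition equivalent_categories :: "('o, 'm) cat \<Rightarrow> ('p, 'n) cat \<Rightarrow> bool" where
  "equivalent_categories C D \<longleftrightarrow> category C \<and> category D \<and>
     (\<exists>Fo Fm Go Gm \<eta> \<epsilon>.
        is_functor C D Fo Fm \<and> is_functor D C Go Gm \<and>
        natural_iso C C (\<lambda>X. X) (\<lambda>X Y f. f)
          (\<lambda>X. Go (Fo X)) (\<lambda>X Y f. Gm (Fo X) (Fo Y) (Fm X Y f)) \<eta> \<and>
        natural_iso D D (\<lambda>X. Fo (Go X)) (\<lambda>X Y f. Fm (Go X) (Go Y) (Gm X Y f))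
          (\<lambda>X. X) (\<lambda>X Y f. f) \<epsilon>)"

definition kleisli ::
  "('o, 'm) cat \<Rightarrow> ('o \<Rightarrow> 'o) \<Rightarrow> ('o \<Rightarrow> 'o \<Rightarrow> 'm \<Rightarrow> 'm) \<Rightarrow> ('o \<Rightarrow> 'm) \<Rightarrow> ('o \<Rightarrow> 'm)
     \<Rightarrow> ('o, 'm) cat" where
  "kleisli C So Sm \<eta> \<mu> =
     \<lparr>Obj = Obj C,
      Hom = (\<lambda>X Y. Hom C X (So Y)),
      Ident = \<eta>,
      Comp = (\<lambda>X Y Z g f. Comp C X (So (So Z)) (So Z) (\<mu> Z)
                (Comp C X (So Y) (So (So Z)) (Sm Y (So Z) g) f))\<rparr>"


section \<open>The category of sets\<close>

text \<open>
  A monad on the category of sets acts on all sets at once and is applied to sets such as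
  \<open>X \<times> Y\<close> and \<open>\<V>\<^sup>X\<close>, so the sets have to live in one type. That type carries a
  Grothendieck universe: a point \<open>x\<close> stands for the set \<open>elts x\<close>, and the sets of the
  category are the sets \<open>X :: 'u set\<close> of the form \<open>elts x\<close>, called small. Infinity and
  foundation are not required, so the finite sets also form such a universe.

  A map \<open>X \<rightarrow> Y\<close> is an element of \<open>X \<rightarrow>\<^sub>E Y\<close>, i.e. it is \<open>undefined\<close> outside of \<open>X\<close>,
  so that equality of maps is equality in HOL.
\<close>

locale universe =
  fixes elts :: "'u \<Rightarrow> 'u set"
  assumes elts_inj: "inj elts"
    and subset_axiom: "B \<subseteq> elts x \<Longrightarrow> B \<in> range elts"
    and pair_axiom: "{x, y} \<in> range elts"
    and union_axiom: "(\<Union>y\<in>elts x. elts y) \<in> range elts"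
    and power_axiom: "{y. elts y \<subseteq> elts x} \<in> range elts"
    and replacement_axiom: "f ` elts x \<in> range elts"
begin

definition small :: "'u set \<Rightarrow> bool" where
  "small X \<longleftrightarrow> X \<in> range elts"

definition code :: "'u set \<Rightarrow> 'u" where
  "code X = (THE x. elts x = X)"

definition one :: "'u set" where
  "one = {code {}}"

definition opair :: "'u \<Rightarrow> 'u \<Rightarrow> 'u" where
  "opair x y = code {code {x}, code {x, y}}"

definition uprod :: "'u set \<Rightarrow> 'u set \<Rightarrow> 'u set" where
  "uprod X Y = {opair x y | x y. x \<in> X \<and> y \<in> Y}"

definition pi1 :: "'u \<Rightarrow> 'u" where
  "pi1 p = (THE x. \<exists>y. p = opair x y)"

definition pi2 :: "'u \<Rightarrow> 'u" where
  "pi2 p = (THE y. \<exists>x. p = opair x y)"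

text \<open>The graph of a map on \<open>X\<close>, as an element of the universe, and the map with graph \<open>p\<close>.\<close>

definition fgraph :: "'u set \<Rightarrow> ('u \<Rightarrow> 'u) \<Rightarrow> 'u" where
  "fgraph X f = code {opair x (f x) | x. x \<in> X}"

definition fapply :: "'u set \<Rightarrow> 'u \<Rightarrow> 'u \<Rightarrow> 'u" where
  "fapply X p = (\<lambda>x\<in>X. THE y. opair x y \<in> elts p)"

text \<open>
  The square \<open>f \<circ> p = g \<circ> q\<close> with \<open>p : P \<rightarrow> X\<close>, \<open>q : P \<rightarrow> Y\<close>, \<open>f : X \<rightarrow> Z\<close>, \<open>g : Y \<rightarrow> Z\<close>
  is a weak pullback.
\<close>

definition weak_pullback ::
  "'u set \<Rightarrow> 'u set \<Rightarrow> 'u set \<Rightarrow> 'u set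
    \<Rightarrow> ('u \<Rightarrow> 'u) \<Rightarrow> ('u \<Rightarrow> 'u) \<Rightarrow> ('u \<Rightarrow> 'u) \<Rightarrow> ('u \<Rightarrow> 'u) \<Rightarrow> bool" where
  "weak_pullback P X Y Z p q f g \<longleftrightarrow>
     p \<in> P \<rightarrow>\<^sub>E X \<and> q \<in> P \<rightarrow>\<^sub>E Y \<and> f \<in> X \<rightarrow>\<^sub>E Z \<and> g \<in> Y \<rightarrow>\<^sub>E Z \<and>
     compose P f p = compose P g q \<and>
     (\<forall>Q p' q'. small Q \<and> p' \<in> Q \<rightarrow>\<^sub>E X \<and> q' \<in> Q \<rightarrow>\<^sub>E Y \<and> compose Q f p' = compose Q g q' \<longrightarrow>
        (\<exists>h\<in>Q \<rightarrow>\<^sub>E P. compose Q p h = p' \<and> compose Q q h = q'))"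

end

text \<open>The monad \<open>(T, e, m)\<close>; \<open>M X Y f\<close> is \<open>T f : T X \<rightarrow> T Y\<close> for \<open>f : X \<rightarrow> Y\<close>.\<close>

locale set_monad = universe elts
  for elts :: "'u \<Rightarrow> 'u set" +
  fixes T :: "'u set \<Rightarrow> 'u set"
    and M :: "'u set \<Rightarrow> 'u set \<Rightarrow> ('u \<Rightarrow> 'u) \<Rightarrow> 'u \<Rightarrow> 'u"
    and e :: "'u set \<Rightarrow> 'u \<Rightarrow> 'u"
    and m :: "'u set \<Rightarrow> 'u \<Rightarrow> 'u"
  assumes T_small: "small X \<Longrightarrow> small (T X)"
    and M_map: "\<lbrakk>small X; small Y; f \<in> X \<rightarrow>\<^sub>E Y\<rbrakk> \<Longrightarrow> M X Y f \<in> T X \<rightarrow>\<^sub>E T Y"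
    and M_id: "small X \<Longrightarrow> M X X (\<lambda>x\<in>X. x) = (\<lambda>x\<in>T X. x)"
    and M_comp: "\<lbrakk>small X; small Y; small Z; f \<in> X \<rightarrow>\<^sub>E Y; g \<in> Y \<rightarrow>\<^sub>E Z\<rbrakk>
      \<Longrightarrow> M X Z (compose X g f) = compose (T X) (M Y Z g) (M X Y f)"
    and e_map: "small X \<Longrightarrow> e X \<in> X \<rightarrow>\<^sub>E T X"
    and e_natural: "\<lbrakk>small X; small Y; f \<in> X \<rightarrow>\<^sub>E Y\<rbrakk>
      \<Longrightarrow> compose X (e Y) f = compose X (M X Y f) (e X)"
    and m_map: "small X \<Longrightarrow> m X \<in> T (T X) \<rightarrow>\<^sub>E T X"
    and m_natural: "\<lbrakk>small X; small Y; f \<in> X \<rightarrow>\<^sub>E Y\<rbrakk>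
      \<Longrightarrow> compose (T (T X)) (m Y) (M (T X) (T Y) (M X Y f)) = compose (T (T X)) (M X Y f) (m X)"
    and m_e: "small X \<Longrightarrow> compose (T X) (m X) (e (T X)) = (\<lambda>x\<in>T X. x)"
    and m_Te: "small X \<Longrightarrow> compose (T X) (m X) (M X (T X) (e X)) = (\<lambda>x\<in>T X. x)"
    and m_assoc: "small X \<Longrightarrow>
      compose (T (T (T X))) (m X) (m (T X)) = compose (T (T (T X))) (m X) (M (T (T X)) (T X) (m X))"


section \<open>Quantales and quantale-valued relations\<close>

locale quantale = comm_monoid tensor k
  for tensor :: "'v::complete_lattice \<Rightarrow> 'v \<Rightarrow> 'v" (infixl "\<otimes>" 70) and k :: 'v +
  assumes tensor_Sup: "x \<otimes> Sup A = (SUP y\<in>A. x \<otimes> y)"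
begin

definition hom :: "'v \<Rightarrow> 'v \<Rightarrow> 'v" where
  "hom y z = Sup {x. x \<otimes> y \<le> z}"

text \<open>
  Relations from \<open>X\<close> to \<open>Y\<close> are extended by \<open>\<bottom>\<close> outside of \<open>X \<times> Y\<close>. Since \<open>\<bottom> \<otimes> v = \<bottom>\<close>,
  the supremum in \<open>vcomp s r\<close> (the composite \<open>s \<cdot> r\<close>) is the one over the intermediate set,
  and the pointwise order of relations is the order of the function type.
\<close>

definition vrel :: "'u set \<Rightarrow> 'u set \<Rightarrow> ('u \<Rightarrow> 'u \<Rightarrow> 'v) set" where
  "vrel X Y = {r. \<forall>x y. x \<notin> X \<or> y \<notin> Y \<longrightarrow> r x y = bot}"

definition vcomp :: "('u \<Rightarrow> 'u \<Rightarrow> 'v) \<Rightarrow> ('u \<Rightarrow> 'u \<Rightarrow> 'v) \<Rightarrow> 'u \<Rightarrow> 'u \<Rightarrow> 'v" where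
  "vcomp s r = (\<lambda>x z. SUP y. r x y \<otimes> s y z)"

definition vconv :: "('u \<Rightarrow> 'u \<Rightarrow> 'v) \<Rightarrow> 'u \<Rightarrow> 'u \<Rightarrow> 'v" where
  "vconv r = (\<lambda>y x. r x y)"

definition vgraph :: "'u set \<Rightarrow> ('u \<Rightarrow> 'u) \<Rightarrow> 'u \<Rightarrow> 'u \<Rightarrow> 'v" where
  "vgraph X f = (\<lambda>x y. if x \<in> X \<and> f x = y then k else bot)"

end


section \<open>Topological theories\<close>

text \<open>
  The underlying set of the quantale is the type \<open>'v\<close>; the injection \<open>cd\<close> makes it a small
  set, \<open>VS\<close>. The map \<open>\<xi>\<close> matters on \<open>T VS\<close> only.
\<close>

locale theory_data = set_monad elts T M e m + quantale tensor k
  for elts :: "'u \<Rightarrow> 'u set"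
    and T :: "'u set \<Rightarrow> 'u set"
    and M :: "'u set \<Rightarrow> 'u set \<Rightarrow> ('u \<Rightarrow> 'u) \<Rightarrow> 'u \<Rightarrow> 'u"
    and e :: "'u set \<Rightarrow> 'u \<Rightarrow> 'u"
    and m :: "'u set \<Rightarrow> 'u \<Rightarrow> 'u"
    and tensor :: "'v::complete_lattice \<Rightarrow> 'v \<Rightarrow> 'v" (infixl "\<otimes>" 70)
    and k :: 'v +
  fixes \<xi> :: "'u \<Rightarrow> 'v"
    and cd :: "'v \<Rightarrow> 'u"
  assumes cd_inj: "inj cd"
    and cd_small: "small (range cd)"
begin

definition VS :: "'u set" where
  "VS = range cd"

definition dec :: "'u \<Rightarrow> 'v" where
  "dec = inv cd"

text \<open>The map \<open>\<xi> \<cdot> T\<phi> : T X \<rightarrow> \<V>\<close> for \<open>\<phi> : X \<rightarrow> \<V>\<close>.\<close>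

definition xiT :: "'u set \<Rightarrow> ('u \<Rightarrow> 'v) \<Rightarrow> 'u \<Rightarrow> 'v" where
  "xiT X \<phi> = (\<lambda>\<xx>. \<xi> (M X VS (\<lambda>x\<in>X. cd (\<phi> x)) \<xx>))"

definition pushforward :: "'u set \<Rightarrow> ('u \<Rightarrow> 'u) \<Rightarrow> ('u \<Rightarrow> 'v) \<Rightarrow> 'u \<Rightarrow> 'v" where
  "pushforward X f \<phi> = (\<lambda>y. SUP x\<in>{x \<in> X. f x = y}. \<phi> x)"

end

locale topological_theory = theory_data elts T M e m tensor k \<xi> cd
  for elts :: "'u \<Rightarrow> 'u set"
    and T :: "'u set \<Rightarrow> 'u set"
    and M :: "'u set \<Rightarrow> 'u set \<Rightarrow> ('u \<Rightarrow> 'u) \<Rightarrow> 'u \<Rightarrow> 'u"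
    and e :: "'u set \<Rightarrow> 'u \<Rightarrow> 'u"
    and m :: "'u set \<Rightarrow> 'u \<Rightarrow> 'u"
    and tensor :: "'v::complete_lattice \<Rightarrow> 'v \<Rightarrow> 'v" (infixl "\<otimes>" 70)
    and k :: 'v
    and \<xi> :: "'u \<Rightarrow> 'v"
    and cd :: "'v \<Rightarrow> 'u" +
  assumes T_weak_pullback:
      "\<lbrakk>small P; small X; small Y; small Z; weak_pullback P X Y Z p q f g\<rbrakk>
       \<Longrightarrow> weak_pullback (T P) (T X) (T Y) (T Z) (M P X p) (M P Y q) (M X Z f) (M Y Z g)"
    and m_weak_pullback:
      "\<lbrakk>small X; small Y; f \<in> X \<rightarrow>\<^sub>E Y\<rbrakk>
       \<Longrightarrow> weak_pullback (T (T X)) (T X) (T (T Y)) (T Y)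
             (m X) (M (T X) (T Y) (M X Y f)) (M X Y f) (m Y)"
    and xi_unit: "\<xi> (e VS (cd v)) = v"
    and xi_mult: "\<WW> \<in> T (T VS) \<Longrightarrow> xiT (T VS) \<xi> \<WW> = \<xi> (m VS \<WW>)"
    and xi_tensor:
      "\<ww> \<in> T (uprod VS VS) \<Longrightarrow>
         xiT (uprod VS VS) (\<lambda>p. dec (pi1 p) \<otimes> dec (pi2 p)) \<ww>
         = \<xi> (M (uprod VS VS) VS (\<lambda>p\<in>uprod VS VS. pi1 p) \<ww>)
           \<otimes> \<xi> (M (uprod VS VS) VS (\<lambda>p\<in>uprod VS VS. pi2 p) \<ww>)"
    and xi_k: "\<tt> \<in> T one \<Longrightarrow> xiT one (\<lambda>_. k) \<tt> = k"
    and xi_pushforward: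
      "\<lbrakk>small X; small Y; f \<in> X \<rightarrow>\<^sub>E Y; \<yy> \<in> T Y\<rbrakk>
       \<Longrightarrow> xiT Y (pushforward X f \<phi>) \<yy> = pushforward (T X) (M X Y f) (xiT X \<phi>) \<yy>"
begin

subsection \<open>Categories over the theory\<close>

text \<open>The extension \<open>T\<^sub>\<xi> r\<close> of a relation \<open>r\<close> from \<open>X\<close> to \<open>Y\<close>.\<close>

definition Txi :: "'u set \<Rightarrow> 'u set \<Rightarrow> ('u \<Rightarrow> 'u \<Rightarrow> 'v) \<Rightarrow> 'u \<Rightarrow> 'u \<Rightarrow> 'v" where
  "Txi X Y r = (\<lambda>\<xx> \<yy>. Sup {xiT (uprod X Y) (\<lambda>p. r (pi1 p) (pi2 p)) \<ww> | \<ww>.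
      \<ww> \<in> T (uprod X Y) \<and>
      M (uprod X Y) X (\<lambda>p\<in>uprod X Y. pi1 p) \<ww> = \<xx> \<and>
      M (uprod X Y) Y (\<lambda>p\<in>uprod X Y. pi2 p) \<ww> = \<yy>})"

definition Tcategory :: "'u set \<times> ('u \<Rightarrow> 'u \<Rightarrow> 'v) \<Rightarrow> bool" where
  "Tcategory = (\<lambda>(X, a). small X \<and> a \<in> vrel (T X) X \<and>
     vconv (vgraph X (e X)) \<le> a \<and>
     vcomp (vcomp a (Txi (T X) X a)) (vconv (vgraph (T (T X)) (m X))) \<le> a)"

definition Tfunctor ::
  "'u set \<times> ('u \<Rightarrow> 'u \<Rightarrow> 'v) \<Rightarrow> 'u set \<times> ('u \<Rightarrow> 'u \<Rightarrow> 'v) \<Rightarrow> ('u \<Rightarrow> 'u) \<Rightarrow> bool" where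
  "Tfunctor = (\<lambda>(X, a) (Y, b) f. f \<in> X \<rightarrow>\<^sub>E Y \<and>
     (\<forall>\<xx>\<in>T X. \<forall>x\<in>X. a \<xx> x \<le> b (M X Y f \<xx>) (f x)))"

text \<open>\<open>under (X, a)\<close> is \<open>a\<^sub>0 = a \<cdot> e\<^sub>X\<close>.\<close>

definition under :: "'u set \<times> ('u \<Rightarrow> 'u \<Rightarrow> 'v) \<Rightarrow> 'u \<Rightarrow> 'u \<Rightarrow> 'v" where
  "under = (\<lambda>(X, a). vcomp a (vgraph X (e X)))"

text \<open>The order and the equivalence of maps from the set \<open>X\<close> to the category \<open>B\<close>.\<close>

definition map_le ::
  "'u set \<Rightarrow> 'u set \<times> ('u \<Rightarrow> 'u \<Rightarrow> 'v) \<Rightarrow> ('u \<Rightarrow> 'u) \<Rightarrow> ('u \<Rightarrow> 'u) \<Rightarrow> bool" where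
  "map_le X B f g \<longleftrightarrow> (\<forall>x\<in>X. k \<le> under B (f x) (g x))"

definition map_equiv ::
  "'u set \<Rightarrow> 'u set \<times> ('u \<Rightarrow> 'u \<Rightarrow> 'v) \<Rightarrow> ('u \<Rightarrow> 'u) \<Rightarrow> ('u \<Rightarrow> 'u) \<Rightarrow> bool" where
  "map_equiv X B f g \<longleftrightarrow> map_le X B f g \<and> map_le X B g f"

definition adjoint ::
  "'u set \<times> ('u \<Rightarrow> 'u \<Rightarrow> 'v) \<Rightarrow> 'u set \<times> ('u \<Rightarrow> 'u \<Rightarrow> 'v)
     \<Rightarrow> ('u \<Rightarrow> 'u) \<Rightarrow> ('u \<Rightarrow> 'u) \<Rightarrow> bool" where
  "adjoint A B f g \<longleftrightarrow> Tfunctor A B f \<and> Tfunctor B A g \<and>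
     map_le (fst A) A (\<lambda>x\<in>fst A. x) (compose (fst A) g f) \<and>
     map_le (fst B) B (compose (fst B) f g) (\<lambda>y\<in>fst B. y)"


subsection \<open>Representable categories\<close>

definition Tcat_T :: "'u set \<times> ('u \<Rightarrow> 'u \<Rightarrow> 'v) \<Rightarrow> 'u set \<times> ('u \<Rightarrow> 'u \<Rightarrow> 'v)" where
  "Tcat_T = (\<lambda>(X, a). (T X,
     vcomp (vcomp (Txi (T X) X a) (vconv (vgraph (T (T X)) (m X)))) (vgraph (T (T X)) (m X))))"

text \<open>\<open>\<alpha> : T X \<rightarrow> X\<close> is left adjoint to \<open>e\<^sub>X\<close>.\<close>

definition repr_adjoint :: "'u set \<times> ('u \<Rightarrow> 'u \<Rightarrow> 'v) \<Rightarrow> ('u \<Rightarrow> 'u) \<Rightarrow> bool" where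
  "repr_adjoint A \<alpha> \<longleftrightarrow> adjoint (Tcat_T A) A \<alpha> (e (fst A))"

definition representable :: "'u set \<times> ('u \<Rightarrow> 'u \<Rightarrow> 'v) \<Rightarrow> bool" where
  "representable A \<longleftrightarrow> Tcategory A \<and> (\<exists>\<alpha>. repr_adjoint A \<alpha>)"

text \<open>Left adjoints are unique up to equivalence, so it does not matter which ones are used.\<close>

definition pseudo_hom ::
  "'u set \<times> ('u \<Rightarrow> 'u \<Rightarrow> 'v) \<Rightarrow> 'u set \<times> ('u \<Rightarrow> 'u \<Rightarrow> 'v) \<Rightarrow> ('u \<Rightarrow> 'u) \<Rightarrow> bool" where
  "pseudo_hom A B f \<longleftrightarrow> Tfunctor A B f \<and>
     (\<exists>\<alpha> \<beta>. repr_adjoint A \<alpha> \<and> repr_adjoint B \<beta> \<and>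
        map_equiv (T (fst A)) B
          (compose (T (fst A)) \<beta> (M (fst A) (fst B) f)) (compose (T (fst A)) f \<alpha>))"

definition ReprCat :: "('u set \<times> ('u \<Rightarrow> 'u \<Rightarrow> 'v), 'u \<Rightarrow> 'u) cat" where
  "ReprCat =
     \<lparr>Obj = {A. representable A},
      Hom = (\<lambda>A B. {f. pseudo_hom A B f}),
      Ident = (\<lambda>A. \<lambda>x\<in>fst A. x),
      Comp = (\<lambda>A B C g f. compose (fst A) g f)\<rparr>"

definition repr_dist ::
  "'u set \<times> ('u \<Rightarrow> 'u \<Rightarrow> 'v) \<Rightarrow> 'u set \<times> ('u \<Rightarrow> 'u \<Rightarrow> 'v) \<Rightarrow> ('u \<Rightarrow> 'u \<Rightarrow> 'v) \<Rightarrow> bool" where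
  "repr_dist A B \<psi> \<longleftrightarrow> \<psi> \<in> vrel (fst A) (fst B) \<and>
     vcomp \<psi> (under A) \<le> \<psi> \<and> vcomp (under B) \<psi> \<le> \<psi> \<and>
     vcomp \<psi> (snd A) = vcomp (snd B) (Txi (fst A) (fst B) \<psi>)"

definition ReprDist :: "('u set \<times> ('u \<Rightarrow> 'u \<Rightarrow> 'v), 'u \<Rightarrow> 'u \<Rightarrow> 'v) cat" where
  "ReprDist =
     \<lparr>Obj = {A. representable A},
      Hom = (\<lambda>A B. {\<psi>. repr_dist A B \<psi>}),
      Ident = under,
      Comp = (\<lambda>A B C s r. vcomp s r)\<rparr>"


subsection \<open>The monad of V-valued functors\<close>

definition V_cat :: "'u set \<times> ('u \<Rightarrow> 'u \<Rightarrow> 'v)" where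
  "V_cat = (VS, \<lambda>\<vv> v. if \<vv> \<in> T VS \<and> v \<in> VS then hom (\<xi> \<vv>) (dec v) else bot)"

text \<open>
  \<open>funs A\<close> is \<open>\<V>\<^sup>X\<close>. Its elements are the graphs of the functors \<open>\<phi>\<close> from \<open>A\<close> to \<open>\<V>\<close>,
  which are recovered by \<open>fapply\<close>.
\<close>

definition funs :: "'u set \<times> ('u \<Rightarrow> 'u \<Rightarrow> 'v) \<Rightarrow> 'u set" where
  "funs A = {fgraph (fst A) \<phi> | \<phi>. Tfunctor A V_cat \<phi>}"

definition ev :: "'u set \<times> ('u \<Rightarrow> 'u \<Rightarrow> 'v) \<Rightarrow> 'u \<Rightarrow> 'u \<Rightarrow> 'v" where
  "ev A = (\<lambda>\<phi> x. if \<phi> \<in> funs A \<and> x \<in> fst A then dec (fapply (fst A) \<phi> x) else bot)"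

definition \<mu> :: "'u set \<times> ('u \<Rightarrow> 'u \<Rightarrow> 'v) \<Rightarrow> 'u \<Rightarrow> 'u \<Rightarrow> 'v" where
  "\<mu> A = vcomp (snd A) (Txi (funs A) (fst A) (ev A))"

definition V_obj :: "'u set \<times> ('u \<Rightarrow> 'u \<Rightarrow> 'v) \<Rightarrow> 'u set \<times> ('u \<Rightarrow> 'u \<Rightarrow> 'v)" where
  "V_obj A = (funs A, \<lambda>\<pp> \<phi>. if \<pp> \<in> T (funs A) \<and> \<phi> \<in> funs A
      then INF x\<in>fst A. hom (ev A \<phi> x) (\<mu> A \<pp> x) else bot)"

definition V_map ::
  "'u set \<times> ('u \<Rightarrow> 'u \<Rightarrow> 'v) \<Rightarrow> 'u set \<times> ('u \<Rightarrow> 'u \<Rightarrow> 'v) \<Rightarrow> ('u \<Rightarrow> 'u) \<Rightarrow> 'u \<Rightarrow> 'u" where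
  "V_map A B f = (\<lambda>\<phi>\<in>funs A. fgraph (fst B) (\<lambda>y\<in>fst B.
      cd (SUP \<xx>\<in>T (fst A).
        \<xi> (M (fst A) VS (fapply (fst A) \<phi>) \<xx>) \<otimes> snd B (M (fst A) (fst B) f \<xx>) y)))"

definition V_unit :: "'u set \<times> ('u \<Rightarrow> 'u \<Rightarrow> 'v) \<Rightarrow> 'u \<Rightarrow> 'u" where
  "V_unit A = (\<lambda>x\<in>fst A. fgraph (fst A) (\<lambda>y\<in>fst A. cd (under A x y)))"

definition V_mult :: "'u set \<times> ('u \<Rightarrow> 'u \<Rightarrow> 'v) \<Rightarrow> 'u \<Rightarrow> 'u" where
  "V_mult A = (\<lambda>\<Phi>\<in>funs (V_obj A). fgraph (fst A)
      (\<lambda>x\<in>fst A. fapply (funs A) \<Phi> (V_unit A x)))"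

definition ReprCat_V :: "('u set \<times> ('u \<Rightarrow> 'u \<Rightarrow> 'v), 'u \<Rightarrow> 'u) cat" where
  "ReprCat_V = kleisli ReprCat V_obj V_map V_unit V_mult"

end

end

theory Submission
  imports Defs
begin

text \<open>
  A map \<open>f\<close> from \<open>X\<close> into the set of functors \<open>Y \<rightarrow> \<V>\<close> is the same thing as a \<open>\<V>\<close>-relation from \<open>X\<close>
  to \<open>Y\<close>, its mate \<open>\<psi>(x, y) = f(x)(y)\<close>. The equivalence is the identity on objects and sends a
  Kleisli morphism \<open>f : X \<rightarrow> V Y\<close> to \<open>\<psi>\<close>. What has to be seen is that the conditions on \<open>f\<close> and on \<open>\<psi>\<close> agree.

  Write \<open>a\<close> and \<open>b\<close> for the structures of \<open>X\<close> and \<open>Y\<close>. The definition of \<open>V Y\<close> turns functoriality of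
  \<open>f\<close> into the inequality \<open>\<psi> \<cdot> a \<le> b \<cdot> T\<^sub>\<xi> \<psi>\<close>. If \<open>\<alpha>\<close> is left adjoint to \<open>e\<^sub>X\<close>, then
  \<open>a = a\<^sub>0 \<cdot> \<alpha>\<close>, so that \<open>\<psi> \<cdot> a = \<psi> \<cdot> \<alpha>\<close> for a distributor \<open>\<psi>\<close>. The left adjoint of
  \<open>e\<close> for \<open>V Y\<close> is \<open>\<pp> \<mapsto> \<mu>(\<pp>, -)\<close>, and \<open>\<mu> \<cdot> T f = b \<cdot> T\<^sub>\<xi> \<psi>\<close>. As \<open>V Y\<close> is separated, equivalent maps into it are
  equal. Hence \<open>f\<close> is a pseudo-homomorphism precisely when \<open>\<psi> \<cdot> a = b \<cdot> T\<^sub>\<xi> \<psi>\<close> (\<open>pseudo_hom_V_obj_iff\<close>). That each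
  \<open>\<psi>(x, -)\<close> is a functor is the inequality \<open>b \<cdot> T\<^sub>\<xi> \<psi> \<cdot> e \<le> \<psi>\<close>; here \<open>T 1 = 1\<close> identifies
  \<open>\<xi> \<cdot> T(\<psi>(x, -))\<close> with \<open>T\<^sub>\<xi> \<psi>(e(x), -)\<close> (\<open>Txi_point\<close>).

  The unit of the monad is the mate of the identity \<open>a\<^sub>0\<close>. Kleisli composites are mates of relational
  composites (\<open>kleisli_comp_value\<close>): evaluating the structure of \<open>V Z\<close> at a
  representable functor gives \<open>\<mu>\<close>, by the Yoneda argument of \<open>Vstr_unit\<close>, and a functor
  \<open>\<phi>\<close> satisfies \<open>\<phi>(y) = \<Squnion>\<^sub>\<yy> \<xi> T\<phi>(\<yy>) \<otimes> b(\<yy>, y)\<close>.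

  Since these bijections preserve units and composites, the category laws of the Kleisli category are
  those of the category of distributors (\<open>equivalent_categoriesI\<close>), where they reduce to
  associativity of relational composition and functoriality of \<open>T\<^sub>\<xi>\<close>. Functoriality of \<open>T\<^sub>\<xi>\<close>
  (\<open>Txi_vcomp\<close>) and its compatibility with \<open>m\<close> (\<open>Txi_m\<close>, \<open>Txi_m_le\<close>) come from the weak pullback
  conditions and from the compatibility of \<open>\<xi>\<close> with \<open>\<otimes>\<close>, with \<open>m\<close> and with suprema along maps.
\<close>

section \<open>Equivalences that are bijective on objects and morphisms\<close>

text \<open>
  The category laws of \<open>C\<close> are transported from \<open>D\<close> along the bijections of hom-sets.
\<close>

lemma equivalent_categoriesI:
  assumes D: "category D" and Obj: "Obj C = Obj D"
    and \<Phi>: "\<And>X Y f. X \<in> Obj D \<Longrightarrow> Y \<in> Obj D \<Longrightarrow> f \<in> Hom C X Y \<Longrightarrow> \<Phi> X Y f \<in> Hom D X Y"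
    and \<Psi>: "\<And>X Y g. X \<in> Obj D \<Longrightarrow> Y \<in> Obj D \<Longrightarrow> g \<in> Hom D X Y \<Longrightarrow> \<Psi> X Y g \<in> Hom C X Y"
    and \<Psi>\<Phi>: "\<And>X Y f. X \<in> Obj D \<Longrightarrow> Y \<in> Obj D \<Longrightarrow> f \<in> Hom C X Y \<Longrightarrow> \<Psi> X Y (\<Phi> X Y f) = f"
    and \<Phi>\<Psi>: "\<And>X Y g. X \<in> Obj D \<Longrightarrow> Y \<in> Obj D \<Longrightarrow> g \<in> Hom D X Y \<Longrightarrow> \<Phi> X Y (\<Psi> X Y g) = g"
    and Ident: "\<And>X. X \<in> Obj D \<Longrightarrow> Ident C X = \<Psi> X X (Ident D X)"
    and Comp: "\<And>X Y Z f g. X \<in> Obj D \<Longrightarrow> Y \<in> Obj D \<Longrightarrow> Z \<in> Obj D \<Longrightarrow> f \<in> Hom C X Y \<Longrightarrow> g \<in> Hom C Y Z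
      \<Longrightarrow> Comp C X Y Z g f = \<Psi> X Z (Comp D X Y Z (\<Phi> Y Z g) (\<Phi> X Y f))"
  shows "equivalent_categories C D"
proof -
  have D1: "Ident D X \<in> Hom D X X" if "X \<in> Obj D" for X
    using D that by (simp add: category_def)
  have D2: "Comp D X Y Z g f \<in> Hom D X Z"
    if "X \<in> Obj D" "Y \<in> Obj D" "Z \<in> Obj D" "f \<in> Hom D X Y" "g \<in> Hom D Y Z" for X Y Z f g
    using D that by (simp add: category_def)
  have D3: "Comp D X X Y f (Ident D X) = f" "Comp D X Y Y (Ident D Y) f = f"
    if "X \<in> Obj D" "Y \<in> Obj D" "f \<in> Hom D X Y" for X Y f
    using D that by (simp_all add: category_def)
  have D4: "Comp D W Y Z h (Comp D W X Y g f) = Comp D W X Z (Comp D X Y Z h g) f"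
    if "W \<in> Obj D" "X \<in> Obj D" "Y \<in> Obj D" "Z \<in> Obj D"
      "f \<in> Hom D W X" "g \<in> Hom D X Y" "h \<in> Hom D Y Z" for W X Y Z f g h
    using D that by (simp add: category_def)
  have C1: "Ident C X \<in> Hom C X X" and \<Phi>I: "\<Phi> X X (Ident C X) = Ident D X" if "X \<in> Obj D" for X
    using that by (simp_all add: Ident \<Psi> \<Phi>\<Psi> D1)
  have C2: "Comp C X Y Z g f \<in> Hom C X Z"
    and \<Phi>C: "\<Phi> X Z (Comp C X Y Z g f) = Comp D X Y Z (\<Phi> Y Z g) (\<Phi> X Y f)"
    if "X \<in> Obj D" "Y \<in> Obj D" "Z \<in> Obj D" "f \<in> Hom C X Y" "g \<in> Hom C Y Z" for X Y Z f g
    using that by (simp_all add: Comp \<Phi> \<Psi> \<Phi>\<Psi> D2)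
  have C3: "Comp C X X Y f (Ident C X) = f" "Comp C X Y Y (Ident C Y) f = f"
    if "X \<in> Obj D" "Y \<in> Obj D" "f \<in> Hom C X Y" for X Y f
    using that by (simp_all add: Comp C1 \<Phi>I \<Phi> D3 \<Psi>\<Phi>)
  have C4: "Comp C W Y Z h (Comp C W X Y g f) = Comp C W X Z (Comp C X Y Z h g) f"
    if X: "W \<in> Obj D" "X \<in> Obj D" "Y \<in> Obj D" "Z \<in> Obj D"
      "f \<in> Hom C W X" "g \<in> Hom C X Y" "h \<in> Hom C Y Z" for W X Y Z f g h
  proof -
    have "Comp C W Y Z h (Comp C W X Y g f)
        = \<Psi> W Z (Comp D W Y Z (\<Phi> Y Z h) (Comp D W X Y (\<Phi> X Y g) (\<Phi> W X f)))"
      using X by (subst Comp) (simp_all add: C2 \<Phi>C)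
    also have "\<dots> = \<Psi> W Z (Comp D W X Z (Comp D X Y Z (\<Phi> Y Z h) (\<Phi> X Y g)) (\<Phi> W X f))"
      using X by (simp add: D4 \<Phi>)
    also have "\<dots> = Comp C W X Z (Comp C X Y Z h g) f"
      using X Comp[of W X Z f "Comp C X Y Z h g"] by (simp add: C2 \<Phi>C)
    finally show ?thesis .
  qed
  have catC: "category C"
    unfolding category_def Obj by (intro conjI ballI C1 C2 C3 C4)
  have F: "is_functor C D (\<lambda>X. X) \<Phi>"
    unfolding is_functor_def Obj by (intro conjI ballI \<Phi> \<Phi>I \<Phi>C)
  have G: "is_functor D C (\<lambda>X. X) \<Psi>"
    unfolding is_functor_def Obj by (auto simp: Ident Comp \<Psi> \<Phi>\<Psi>)
  have isoC: "is_iso C X X (Ident C X)" if "X \<in> Obj D" for X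
    unfolding is_iso_def using that C1 C3 by blast
  have isoD: "is_iso D X X (Ident D X)" if "X \<in> Obj D" for X
    unfolding is_iso_def using that D1 D3 by blast
  have "natural_iso C C (\<lambda>X. X) (\<lambda>X Y f. f) (\<lambda>X. X) (\<lambda>X Y f. \<Psi> X Y (\<Phi> X Y f)) (Ident C)"
    unfolding natural_iso_def Obj by (simp add: isoC C3 \<Psi>\<Phi>)
  moreover have "natural_iso D D (\<lambda>X. X) (\<lambda>X Y g. \<Phi> X Y (\<Psi> X Y g)) (\<lambda>X. X) (\<lambda>X Y f. f) (Ident D)"
    unfolding natural_iso_def by (simp add: isoD D3 \<Phi>\<Psi>)
  ultimately show ?thesis
    unfolding equivalent_categories_def using catC D F G by blast
qed

section \<open>Sets of the universe\<close>

context universe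
begin

lemma elts_code [simp]: "small X \<Longrightarrow> elts (code X) = X"
  using inj_eq[OF elts_inj] by (auto simp: small_def code_def)

lemma code_eq_iff: "small X \<Longrightarrow> small Y \<Longrightarrow> code X = code Y \<longleftrightarrow> X = Y"
  by (metis elts_code)

lemma small_subset: "B \<subseteq> X \<Longrightarrow> small X \<Longrightarrow> small B"
  by (metis elts_code small_def subset_axiom)

lemma small_pair [simp]: "small {x, y}"
  by (simp add: small_def pair_axiom)

lemma small_singleton [simp]: "small {x}"
  using small_pair[of x x] by simp

lemma small_image: "small X \<Longrightarrow> small (f ` X)"
  by (metis elts_code small_def replacement_axiom)

lemma small_Union: "small I \<Longrightarrow> (\<And>i. i \<in> I \<Longrightarrow> small (X i)) \<Longrightarrow> small (\<Union>i\<in>I. X i)"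
proof -
  assume "small I" and X: "\<And>i. i \<in> I \<Longrightarrow> small (X i)"
  then have "small ((\<lambda>i. code (X i)) ` I)" by (simp add: small_image)
  then have "small (\<Union>y\<in>(\<lambda>i. code (X i)) ` I. elts y)"
    by (metis elts_code small_def union_axiom)
  then show ?thesis using X by simp
qed

lemma small_one [simp]: "small one"
  by (simp add: one_def)

lemma opair_inject [simp]: "opair x y = opair x' y' \<longleftrightarrow> x = x' \<and> y = y'"
  by (auto simp: opair_def code_eq_iff doubleton_eq_iff)

lemma pi1_opair [simp]: "pi1 (opair x y) = x"
  by (simp add: pi1_def)

lemma pi2_opair [simp]: "pi2 (opair x y) = y"
  by (simp add: pi2_def)

lemma opair_in_uprod [simp]: "opair x y \<in> uprod X Y \<longleftrightarrow> x \<in> X \<and> y \<in> Y"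
  by (auto simp: uprod_def)

lemma uprodE [elim!]:
  assumes "p \<in> uprod X Y"
  obtains x y where "p = opair x y" "x \<in> X" "y \<in> Y"
  using assms by (auto simp: uprod_def)

lemma pi1_in [simp]: "p \<in> uprod X Y \<Longrightarrow> pi1 p \<in> X"
  and pi2_in [simp]: "p \<in> uprod X Y \<Longrightarrow> pi2 p \<in> Y"
  and opair_pi [simp]: "p \<in> uprod X Y \<Longrightarrow> opair (pi1 p) (pi2 p) = p"
  by (auto simp: uprod_def)

lemma small_uprod [simp]: "small X \<Longrightarrow> small Y \<Longrightarrow> small (uprod X Y)"
proof -
  assume "small X" "small Y"
  moreover have "uprod X Y = (\<Union>x\<in>X. opair x ` Y)" by (auto simp: uprod_def)
  ultimately show ?thesis by (simp add: small_Union small_image)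
qed

lemma small_graph: "small X \<Longrightarrow> small {opair x (f x) |x. x \<in> X}"
  using small_image[of X "\<lambda>x. opair x (f x)"] by (simp add: Setcompr_eq_image)

lemma fapply_fgraph: "small X \<Longrightarrow> f \<in> extensional X \<Longrightarrow> fapply X (fgraph X f) = f"
  by (auto simp: fapply_def fgraph_def small_graph extensional_def fun_eq_iff)

text \<open>
  A graph is a subset of \<open>X \<times> Y\<close>, so the graphs lie in a power set of the universe.
\<close>

lemma small_fgraphs:
  assumes "small X" "small Y"
  shows "small {fgraph X f |f. f \<in> X \<rightarrow>\<^sub>E Y}"
proof (rule small_subset)
  have "elts (fgraph X f) \<subseteq> elts (code (uprod X Y))" if f: "f \<in> X \<rightarrow>\<^sub>E Y" for f
    using PiE_mem[OF f] assms by (auto simp: fgraph_def small_graph)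
  then show "{fgraph X f |f. f \<in> X \<rightarrow>\<^sub>E Y} \<subseteq> {y. elts y \<subseteq> elts (code (uprod X Y))}"
    by blast
  show "small {y. elts y \<subseteq> elts (code (uprod X Y))}"
    by (simp add: small_def power_axiom)
qed

text \<open>
  Weak pullbacks of sets are recognized on elements, by choosing a preimage for every pair of elements
  that agree in \<open>Z\<close>.
\<close>

lemma weak_pullbackI:
  assumes "p \<in> P \<rightarrow> X" "q \<in> P \<rightarrow> Y" "f \<in> X \<rightarrow> Z" "g \<in> Y \<rightarrow> Z"
    and "\<And>z. z \<in> P \<Longrightarrow> f (p z) = g (q z)"
    and lift: "\<And>x y. x \<in> X \<Longrightarrow> y \<in> Y \<Longrightarrow> f x = g y \<Longrightarrow> \<exists>z\<in>P. p z = x \<and> q z = y"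
  shows "weak_pullback P X Y Z (restrict p P) (restrict q P) (restrict f X) (restrict g Y)"
  unfolding weak_pullback_def
proof (intro conjI allI impI)
  fix Q p' q'
  assume Q: "small Q \<and> p' \<in> Q \<rightarrow>\<^sub>E X \<and> q' \<in> Q \<rightarrow>\<^sub>E Y
    \<and> compose Q (restrict f X) p' = compose Q (restrict g Y) q'"
  have "\<exists>z\<in>P. p z = p' u \<and> q z = q' u" if "u \<in> Q" for u
  proof (rule lift)
    show "p' u \<in> X" "q' u \<in> Y" using Q that by auto
    then show "f (p' u) = g (q' u)"
      using Q that
      by (metis (no_types, lifting) compose_eq restrict_apply')
  qed
  then obtain h where h: "\<And>u. u \<in> Q \<Longrightarrow> h u \<in> P \<and> p (h u) = p' u \<and> q (h u) = q' u"
    by metis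
  then show "\<exists>h\<in>Q \<rightarrow>\<^sub>E P. compose Q (restrict p P) h = p' \<and> compose Q (restrict q P) h = q'"
    using Q by (intro bexI[of _ "restrict h Q"])
      (auto simp: compose_def fun_eq_iff PiE_def extensional_def)
qed (use assms in \<open>auto simp: compose_def fun_eq_iff Pi_iff\<close>)

text \<open>
  A pair of elements is a pair of maps from a singleton.
\<close>

lemma weak_pullbackD:
  assumes wp: "weak_pullback P X Y Z p q f g" and x: "x \<in> X" "y \<in> Y" "f x = g y"
  obtains z where "z \<in> P" "p z = x" "q z = y"
proof -
  have "(\<lambda>u\<in>one. x) \<in> one \<rightarrow>\<^sub>E X" "(\<lambda>u\<in>one. y) \<in> one \<rightarrow>\<^sub>E Y"
    "compose one f (\<lambda>u\<in>one. x) = compose one g (\<lambda>u\<in>one. y)"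
    using x by (auto simp: compose_def)
  then obtain h where h: "h \<in> one \<rightarrow>\<^sub>E P" "compose one p h = (\<lambda>u\<in>one. x)"
      "compose one q h = (\<lambda>u\<in>one. y)"
    using wp small_one unfolding weak_pullback_def by blast
  from h(1) have "h (code {}) \<in> P" by (auto simp: one_def)
  moreover have "p (h (code {})) = x" "q (h (code {})) = y"
    using fun_cong[OF h(2), of "code {}"] fun_cong[OF h(3), of "code {}"]
    by (simp_all add: one_def compose_def)
  ultimately show ?thesis using that by blast
qed

end

section \<open>The monad on elements\<close>

context set_monad
begin

text \<open>
  Maps are extensional functions, while in calculations it is convenient to write them as arbitrary
  \<open>\<lambda>\<close>-terms; \<open>Mr X Y f\<close> is \<open>T f\<close> for the restriction of \<open>f\<close> to \<open>X\<close>.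
\<close>

abbreviation Mr :: "'u set \<Rightarrow> 'u set \<Rightarrow> ('u \<Rightarrow> 'u) \<Rightarrow> 'u \<Rightarrow> 'u" where
  "Mr X Y f \<equiv> M X Y (restrict f X)"

lemma small_T [simp]: "small X \<Longrightarrow> small (T X)"
  by (rule T_small)

lemma Mr_in [simp]: "small X \<Longrightarrow> small Y \<Longrightarrow> f \<in> X \<rightarrow> Y \<Longrightarrow> \<xx> \<in> T X \<Longrightarrow> Mr X Y f \<xx> \<in> T Y"
  using M_map[of X Y "restrict f X"] by auto

lemma Mr_Mr:
  assumes "small X" "small Y" "small Z" "f \<in> X \<rightarrow> Y" "g \<in> Y \<rightarrow> Z" "\<xx> \<in> T X"
  shows "Mr Y Z g (Mr X Y f \<xx>) = Mr X Z (\<lambda>x. g (f x)) \<xx>"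
proof -
  have "compose X (restrict g Y) (restrict f X) = restrict (\<lambda>x. g (f x)) X"
    using assms by (auto simp: compose_def fun_eq_iff)
  then show ?thesis
    using M_comp[of X Y Z "restrict f X" "restrict g Y"] assms by (simp add: compose_def)
qed

lemma Mr_id: "small X \<Longrightarrow> \<xx> \<in> T X \<Longrightarrow> Mr X X (\<lambda>x. x) \<xx> = \<xx>"
  by (simp add: M_id)

lemma e_in [simp]: "small X \<Longrightarrow> x \<in> X \<Longrightarrow> e X x \<in> T X"
  using e_map by blast

lemma e_Mr: "small X \<Longrightarrow> small Y \<Longrightarrow> f \<in> X \<rightarrow> Y \<Longrightarrow> x \<in> X \<Longrightarrow> Mr X Y f (e X x) = e Y (f x)"
  using fun_cong[OF e_natural[of X Y "restrict f X"], of x] by (simp add: compose_def)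

lemma m_in [simp]: "small X \<Longrightarrow> \<XX> \<in> T (T X) \<Longrightarrow> m X \<XX> \<in> T X"
  using m_map by blast

lemma m_Mr:
  assumes "small X" "small Y" "f \<in> X \<rightarrow> Y" "\<XX> \<in> T (T X)"
  shows "m Y (Mr (T X) (T Y) (Mr X Y f) \<XX>) = Mr X Y f (m X \<XX>)"
proof -
  have "restrict (Mr X Y f) (T X) = Mr X Y f"
    using M_map[of X Y "restrict f X"] assms by (auto simp: PiE_restrict)
  then show ?thesis
    using fun_cong[OF m_natural[of X Y "restrict f X"], of \<XX>] assms by (simp add: compose_def)
qed

lemma m_e_T: "small X \<Longrightarrow> \<xx> \<in> T X \<Longrightarrow> m X (e (T X) \<xx>) = \<xx>"
  using fun_cong[OF m_e, of X \<xx>] by (simp add: compose_def)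

lemma m_T_e: "small X \<Longrightarrow> \<xx> \<in> T X \<Longrightarrow> m X (Mr X (T X) (e X) \<xx>) = \<xx>"
proof -
  assume X: "small X" "\<xx> \<in> T X"
  then have "restrict (e X) X = e X" using e_map[of X] by (auto simp: PiE_restrict)
  then show ?thesis using fun_cong[OF m_Te, of X \<xx>] X by (simp add: compose_def)
qed

end

section \<open>Quantale-valued relations\<close>

context quantale
begin

lemma tensor_mono: "x \<le> x' \<Longrightarrow> y \<le> y' \<Longrightarrow> x \<otimes> y \<le> x' \<otimes> y'"
proof -
  have r: "x \<otimes> y \<le> x \<otimes> y'" if "y \<le> y'" for x y y'
    using tensor_Sup[of x "{y, y'}"] that by (simp add: sup_absorb2 le_iff_sup)
  assume "x \<le> x'" "y \<le> y'"
  then show ?thesis using r commute order_trans by metis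
qed

lemma tensor_bot [simp]: "x \<otimes> bot = bot" "bot \<otimes> x = bot"
  using tensor_Sup[of x "{}"] by (simp_all add: commute)

lemma tensor_SUP: "x \<otimes> (SUP i\<in>I. f i) = (SUP i\<in>I. x \<otimes> f i)"
  by (simp add: tensor_Sup image_image)

lemma SUP_tensor: "(SUP i\<in>I. f i) \<otimes> x = (SUP i\<in>I. f i \<otimes> x)"
  by (simp only: commute[of _ x] tensor_SUP)

lemma le_hom_iff: "x \<le> hom y z \<longleftrightarrow> x \<otimes> y \<le> z"
proof
  assume "x \<le> hom y z"
  then have "x \<otimes> y \<le> hom y z \<otimes> y" by (simp add: tensor_mono)
  also have "\<dots> = (SUP x\<in>{x. x \<otimes> y \<le> z}. x \<otimes> y)"
    using SUP_tensor[of "\<lambda>x. x"] by (simp add: hom_def)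
  also have "\<dots> \<le> z" by (rule SUP_least) simp
  finally show "x \<otimes> y \<le> z" .
next
  assume "x \<otimes> y \<le> z"
  then show "x \<le> hom y z" by (simp add: hom_def Sup_upper)
qed

lemma k_tensor_le: "k \<le> u \<Longrightarrow> v \<le> u \<otimes> v" "k \<le> u \<Longrightarrow> v \<le> v \<otimes> u"
  using tensor_mono[of k u v v] tensor_mono[of v v k u] by (simp_all)

lemma vcomp_assoc: "vcomp t (vcomp s r) = vcomp (vcomp t s) r"
proof (intro ext)
  fix w z
  have "vcomp t (vcomp s r) w z = (SUP y. SUP x. (r w x \<otimes> s x y) \<otimes> t y z)"
    by (simp add: vcomp_def SUP_tensor)
  also have "\<dots> = (SUP x. SUP y. (r w x \<otimes> s x y) \<otimes> t y z)"
    by (rule SUP_commute)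
  also have "\<dots> = vcomp (vcomp t s) r w z"
    by (simp add: vcomp_def tensor_SUP assoc)
  finally show "vcomp t (vcomp s r) w z = vcomp (vcomp t s) r w z" .
qed

lemma vcomp_upper: "r x y \<otimes> s y z \<le> vcomp s r x z"
  unfolding vcomp_def by (rule SUP_upper) simp

lemma vcomp_least: "(\<And>y. r x y \<otimes> s y z \<le> v) \<Longrightarrow> vcomp s r x z \<le> v"
  unfolding vcomp_def by (rule SUP_least) simp

lemma vcomp_leastI:
  assumes "r \<in> vrel X Y" "\<And>y. y \<in> Y \<Longrightarrow> r x y \<otimes> s y z \<le> v"
  shows "vcomp s r x z \<le> v"
proof (rule vcomp_least)
  fix y show "r x y \<otimes> s y z \<le> v"
    using assms by (cases "y \<in> Y") (auto simp: vrel_def)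
qed

lemma vcomp_mono: "s \<le> s' \<Longrightarrow> r \<le> r' \<Longrightarrow> vcomp s r \<le> vcomp s' r'"
  unfolding vcomp_def le_fun_def by (auto intro!: SUP_mono' tensor_mono)

lemma vcomp_in_vrel: "r \<in> vrel X Y \<Longrightarrow> s \<in> vrel Y Z \<Longrightarrow> vcomp s r \<in> vrel X Z"
  unfolding vrel_def vcomp_def by (auto intro!: SUP_eq_const)

lemma vcomp_vgraph: "vcomp s (vgraph X f) x z = (if x \<in> X then s (f x) z else bot)"
proof -
  have "vcomp s (vgraph X f) x z \<le> (if x \<in> X then s (f x) z else bot)"
    by (rule vcomp_least) (auto simp: vgraph_def)
  moreover have "(if x \<in> X then s (f x) z else bot) \<le> vcomp s (vgraph X f) x z"
    using vcomp_upper[of "vgraph X f" x "f x" s z] by (auto simp: vgraph_def)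
  ultimately show ?thesis by (rule antisym)
qed

lemma vcomp_vconv_vgraph: "vcomp s (vconv (vgraph X f)) y z = (SUP x\<in>{x \<in> X. f x = y}. s x z)"
proof (rule antisym)
  show "vcomp s (vconv (vgraph X f)) y z \<le> (SUP x\<in>{x \<in> X. f x = y}. s x z)"
    by (rule vcomp_least) (auto simp: vgraph_def vconv_def intro: SUP_upper)
  show "(SUP x\<in>{x \<in> X. f x = y}. s x z) \<le> vcomp s (vconv (vgraph X f)) y z"
  proof (rule SUP_least)
    fix x assume "x \<in> {x \<in> X. f x = y}"
    then show "s x z \<le> vcomp s (vconv (vgraph X f)) y z"
      using vcomp_upper[of "vconv (vgraph X f)" y x s z] by (simp add: vgraph_def vconv_def)
  qed
qed

end

context topological_theory
begin

section \<open>Functions into the quantale\<close>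

lemma small_VS [simp]: "small VS"
  by (simp add: VS_def cd_small)

lemma cd_in_VS [simp]: "cd v \<in> VS"
  by (simp add: VS_def)

lemma dec_cd [simp]: "dec (cd v) = v"
  by (simp add: dec_def cd_inj)

lemma cd_dec [simp]: "u \<in> VS \<Longrightarrow> cd (dec u) = u"
  by (auto simp: VS_def)

lemma xiT_cong: "(\<And>x. x \<in> X \<Longrightarrow> \<phi> x = \<psi> x) \<Longrightarrow> xiT X \<phi> = xiT X \<psi>"
  unfolding xiT_def by (metis (mono_tags, lifting) restrict_ext)

lemma xiT_Mr:
  assumes "small X" "small Y" "f \<in> X \<rightarrow> Y" "\<xx> \<in> T X"
  shows "xiT Y \<phi> (Mr X Y f \<xx>) = xiT X (\<lambda>x. \<phi> (f x)) \<xx>"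
  unfolding xiT_def using assms by (simp add: Mr_Mr[of X Y VS])

lemma xiT_e: "small X \<Longrightarrow> x \<in> X \<Longrightarrow> xiT X \<phi> (e X x) = \<phi> x"
  by (simp add: xiT_def e_Mr xi_unit)

text \<open>
  The multiplication law of the algebra \<open>\<xi>\<close>, transported along \<open>\<phi>\<close> by naturality of \<open>m\<close>.
\<close>

lemma xiT_m:
  assumes "small X" "\<XX> \<in> T (T X)"
  shows "xiT X \<phi> (m X \<XX>) = xiT (T X) (xiT X \<phi>) \<XX>"
proof -
  let ?c = "Mr X VS (\<lambda>x. cd (\<phi> x))"
  have "xiT X \<phi> (m X \<XX>) = \<xi> (m VS (Mr (T X) (T VS) ?c \<XX>))"
    using assms by (simp add: xiT_def m_Mr)
  also have "\<dots> = xiT (T VS) \<xi> (Mr (T X) (T VS) ?c \<XX>)"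
    using assms by (subst xi_mult) auto
  also have "\<dots> = xiT (T X) (\<lambda>\<xx>. \<xi> (?c \<xx>)) \<XX>"
    using assms by (subst xiT_Mr) auto
  finally show ?thesis by (simp add: xiT_def)
qed

text \<open>
  The law for \<open>\<otimes>\<close> on \<open>T(\<V> \<times> \<V>)\<close>, evaluated at the image of \<open>\<xx>\<close> under the pairing of \<open>\<phi>\<close> and \<open>\<psi>\<close>.
\<close>

lemma xiT_tensor:
  assumes "small X" "\<xx> \<in> T X"
  shows "xiT X (\<lambda>x. \<phi> x \<otimes> \<psi> x) \<xx> = xiT X \<phi> \<xx> \<otimes> xiT X \<psi> \<xx>"
proof -
  let ?p = "\<lambda>x. opair (cd (\<phi> x)) (cd (\<psi> x))"
  have w: "Mr X (uprod VS VS) ?p \<xx> \<in> T (uprod VS VS)"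
    using assms by auto
  show ?thesis
    using xi_tensor[OF w] assms by (simp add: xiT_Mr Mr_Mr) (simp add: xiT_def)
qed

lemma xiT_k:
  assumes "small X" "\<xx> \<in> T X"
  shows "xiT X (\<lambda>_. k) \<xx> = k"
proof -
  have "xiT one (\<lambda>_. k) (Mr X one (\<lambda>_. code {}) \<xx>) = k"
    using assms by (intro xi_k Mr_in) (auto simp: one_def)
  then show ?thesis using assms by (subst (asm) xiT_Mr) (auto simp: one_def)
qed

lemma xiT_pushforward:
  assumes "small X" "small Y" "f \<in> X \<rightarrow> Y" "\<yy> \<in> T Y"
  shows "xiT Y (\<lambda>y. SUP x\<in>{x \<in> X. f x = y}. \<phi> x) \<yy>
    = (SUP \<xx>\<in>{\<xx> \<in> T X. Mr X Y f \<xx> = \<yy>}. xiT X \<phi> \<xx>)"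
proof -
  have "pushforward X (restrict f X) \<phi> = (\<lambda>y. SUP x\<in>{x \<in> X. f x = y}. \<phi> x)"
    unfolding pushforward_def by (intro ext SUP_cong) auto
  then show ?thesis
    using xi_pushforward[of X Y "restrict f X" \<yy> \<phi>] assms by (simp add: pushforward_def)
qed

text \<open>
  Monotonicity is a consequence of the compatibility with suprema along maps. On \<open>X \<times> \<V>\<close> take
  \<open>\<theta>(x, v) = v \<sqinter> \<psi>(x)\<close>. Its supremum along the first projection is \<open>\<psi>\<close>, and its restriction along the section
  \<open>x \<mapsto> (x, \<phi>(x))\<close> of that projection is \<open>\<phi>\<close>.
\<close>

lemma xiT_mono:
  assumes X: "small X" "\<xx> \<in> T X" and le: "\<And>x. x \<in> X \<Longrightarrow> \<phi> x \<le> \<psi> x"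
  shows "xiT X \<phi> \<xx> \<le> xiT X \<psi> \<xx>"
proof -
  let ?P = "uprod X VS"
  let ?\<theta> = "\<lambda>p. inf (dec (pi2 p)) (\<psi> (pi1 p))"
  let ?s = "\<lambda>x. opair x (cd (\<phi> x))"
  have s: "?s \<in> X \<rightarrow> ?P" by simp
  have "xiT X \<phi> \<xx> = xiT ?P ?\<theta> (Mr X ?P ?s \<xx>)"
    using X le by (subst xiT_Mr) (auto intro!: xiT_cong[THEN fun_cong] simp: inf_absorb1)
  also have "\<dots> \<le> (SUP \<ww>\<in>{\<ww> \<in> T ?P. Mr ?P X pi1 \<ww> = \<xx>}. xiT ?P ?\<theta> \<ww>)"
    using X by (intro SUP_upper) (auto simp: Mr_Mr Mr_id)
  also have "\<dots> = xiT X (\<lambda>x. SUP p\<in>{p \<in> ?P. pi1 p = x}. ?\<theta> p) \<xx>"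
    using X by (intro xiT_pushforward[symmetric]) auto
  also have "xiT X (\<lambda>x. SUP p\<in>{p \<in> ?P. pi1 p = x}. ?\<theta> p) = xiT X \<psi>"
  proof (rule xiT_cong, rule antisym)
    fix x assume "x \<in> X"
    then have "opair x (cd (\<psi> x)) \<in> {p \<in> ?P. pi1 p = x}" by simp
    from SUP_upper[OF this, of ?\<theta>] show "\<psi> x \<le> (SUP p\<in>{p \<in> ?P. pi1 p = x}. ?\<theta> p)"
      by simp
  qed (auto intro!: SUP_least)
  finally show ?thesis .
qed

text \<open>
  \<open>T\<close> preserves weak pullbacks, in the form in which it is applied to elements.
\<close>

lemma T_lift:
  assumes "small P" "small X" "small Y" "small Z"
    and "p \<in> P \<rightarrow> X" "q \<in> P \<rightarrow> Y" "f \<in> X \<rightarrow> Z" "g \<in> Y \<rightarrow> Z"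
    and "\<And>z. z \<in> P \<Longrightarrow> f (p z) = g (q z)"
    and "\<And>x y. x \<in> X \<Longrightarrow> y \<in> Y \<Longrightarrow> f x = g y \<Longrightarrow> \<exists>z\<in>P. p z = x \<and> q z = y"
    and "\<xx> \<in> T X" "\<yy> \<in> T Y" "Mr X Z f \<xx> = Mr Y Z g \<yy>"
  obtains \<ww> where "\<ww> \<in> T P" "Mr P X p \<ww> = \<xx>" "Mr P Y q \<ww> = \<yy>"
  using weak_pullbackD[OF T_weak_pullback[OF assms(1-4) weak_pullbackI[OF assms(5-10)]] assms(11-13)]
  by blast

lemma m_lift:
  assumes "small X" "small Y" "f \<in> X \<rightarrow> Y"
    and "\<xx> \<in> T X" "\<YY> \<in> T (T Y)" "Mr X Y f \<xx> = m Y \<YY>"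
  obtains \<XX> where "\<XX> \<in> T (T X)" "m X \<XX> = \<xx>" "Mr (T X) (T Y) (Mr X Y f) \<XX> = \<YY>"
proof -
  have f: "restrict f X \<in> X \<rightarrow>\<^sub>E Y" using assms by auto
  then have r: "restrict (Mr X Y f) (T X) = Mr X Y f"
    using M_map[of X Y "restrict f X"] assms by (auto simp: PiE_restrict)
  show ?thesis
    using weak_pullbackD[OF m_weak_pullback[OF assms(1,2) f] assms(4,5,6)] that r by metis
qed

section \<open>The extension of relations\<close>

lemma Txi_least:
  assumes "\<And>\<ww>. \<ww> \<in> T (uprod X Y) \<Longrightarrow> Mr (uprod X Y) X pi1 \<ww> = \<xx> \<Longrightarrow> Mr (uprod X Y) Y pi2 \<ww> = \<yy>
    \<Longrightarrow> xiT (uprod X Y) (\<lambda>p. r (pi1 p) (pi2 p)) \<ww> \<le> v"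
  shows "Txi X Y r \<xx> \<yy> \<le> v"
  unfolding Txi_def by (rule Sup_least) (use assms in auto)

text \<open>
  Any span \<open>X \<leftarrow> P \<rightarrow> Y\<close> can be used to bound \<open>T\<^sub>\<xi> r\<close> from below, since it factors through \<open>X \<times> Y\<close>. This
  avoids constructing elements of \<open>T(X \<times> Y)\<close> by hand.
\<close>

lemma Txi_upper:
  assumes "small P" "small X" "small Y" "f \<in> P \<rightarrow> X" "g \<in> P \<rightarrow> Y" "\<ww> \<in> T P"
    "Mr P X f \<ww> = \<xx>" "Mr P Y g \<ww> = \<yy>"
  shows "xiT P (\<lambda>p. r (f p) (g p)) \<ww> \<le> Txi X Y r \<xx> \<yy>"
proof -
  let ?h = "\<lambda>p. opair (f p) (g p)"
  have h: "?h \<in> P \<rightarrow> uprod X Y" using assms by auto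
  have "xiT P (\<lambda>p. r (f p) (g p)) \<ww> = xiT (uprod X Y) (\<lambda>p. r (pi1 p) (pi2 p)) (Mr P (uprod X Y) ?h \<ww>)"
    using assms h by (simp add: xiT_Mr)
  also have "\<dots> \<le> Txi X Y r \<xx> \<yy>"
    unfolding Txi_def using assms h
    by (intro Sup_upper CollectI exI[of _ "Mr P (uprod X Y) ?h \<ww>"]) (auto simp: Mr_Mr)
  finally show ?thesis .
qed

lemma Txi_vrel: "small X \<Longrightarrow> small Y \<Longrightarrow> Txi X Y r \<in> vrel (T X) (T Y)"
proof -
  assume "small X" "small Y"
  then have "Txi X Y r \<xx> \<yy> \<le> bot" if "\<xx> \<notin> T X \<or> \<yy> \<notin> T Y" for \<xx> \<yy>
    using that by (intro Txi_least) (auto simp: Pi_def)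
  then show ?thesis by (auto simp: vrel_def bot_unique)
qed

lemma Txi_mono:
  assumes "small X" "small Y" "\<And>x y. x \<in> X \<Longrightarrow> y \<in> Y \<Longrightarrow> r x y \<le> s x y"
  shows "Txi X Y r \<le> Txi X Y s"
proof (intro le_funI)
  fix \<xx> \<yy>
  show "Txi X Y r \<xx> \<yy> \<le> Txi X Y s \<xx> \<yy>"
  proof (rule Txi_least)
    fix \<ww> assume w: "\<ww> \<in> T (uprod X Y)" "Mr (uprod X Y) X pi1 \<ww> = \<xx>" "Mr (uprod X Y) Y pi2 \<ww> = \<yy>"
    have "xiT (uprod X Y) (\<lambda>p. r (pi1 p) (pi2 p)) \<ww> \<le> xiT (uprod X Y) (\<lambda>p. s (pi1 p) (pi2 p)) \<ww>"
      using assms w by (intro xiT_mono) auto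
    also have "\<dots> \<le> Txi X Y s \<xx> \<yy>"
      using assms w by (intro Txi_upper) auto
    finally show "xiT (uprod X Y) (\<lambda>p. r (pi1 p) (pi2 p)) \<ww> \<le> Txi X Y s \<xx> \<yy>" .
  qed
qed

lemma Txi_cong:
  assumes "\<And>x y. x \<in> X \<Longrightarrow> y \<in> Y \<Longrightarrow> r x y = s x y"
  shows "Txi X Y r = Txi X Y s"
proof -
  have "xiT (uprod X Y) (\<lambda>p. r (pi1 p) (pi2 p)) = xiT (uprod X Y) (\<lambda>p. s (pi1 p) (pi2 p))"
    using assms by (intro xiT_cong) auto
  then show ?thesis by (simp add: Txi_def)
qed

text \<open>
  The unit \<open>e\<close> is an oplax natural transformation from the identity to \<open>T\<^sub>\<xi>\<close>; the witness in \<open>T(X \<times> Y)\<close> is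
  \<open>e(x, y)\<close>.
\<close>

lemma Txi_e:
  assumes "small X" "small Y" "x \<in> X" "y \<in> Y"
  shows "r x y \<le> Txi X Y r (e X x) (e Y y)"
proof -
  have "r x y = xiT (uprod X Y) (\<lambda>p. r (pi1 p) (pi2 p)) (e (uprod X Y) (opair x y))"
    using assms by (simp add: xiT_e)
  also have "\<dots> \<le> Txi X Y r (e X x) (e Y y)"
    using assms by (intro Txi_upper) (auto simp: e_Mr)
  finally show ?thesis .
qed

text \<open>
  If \<open>r\<close> contains the graph of \<open>f\<close>, then \<open>T\<^sub>\<xi> r\<close> contains the graph of \<open>T f\<close>, because \<open>\<xi> \<cdot> T k\<close> is constant \<open>k\<close>.
\<close>

lemma k_le_Txi_graph:
  assumes "small X" "small Y" "f \<in> X \<rightarrow> Y" "\<xx> \<in> T X" and k: "\<And>x. x \<in> X \<Longrightarrow> k \<le> r x (f x)"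
  shows "k \<le> Txi X Y r \<xx> (Mr X Y f \<xx>)"
proof -
  have "k = xiT X (\<lambda>_. k) \<xx>" using assms by (simp add: xiT_k)
  also have "\<dots> \<le> xiT X (\<lambda>x. r x (f x)) \<xx>" using assms by (intro xiT_mono) auto
  also have "\<dots> \<le> Txi X Y r \<xx> (Mr X Y f \<xx>)"
    using assms by (intro Txi_upper) (auto simp: Mr_id)
  finally show ?thesis .
qed

text \<open>
  This is the nontrivial half of functoriality of \<open>T\<^sub>\<xi>\<close> for a relation \<open>\<phi>\<close> whose domain is a point: the
  composite is a supremum of \<open>\<phi> \<otimes> s\<close> along the projection \<open>Y \<times> Z \<rightarrow> Z\<close>.
\<close>

lemma xiT_vcomp_le:
  assumes S: "small Y" "small Z" and z: "\<zz> \<in> T Z"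
  shows "xiT Z (\<lambda>z. SUP y\<in>Y. \<phi> y \<otimes> s y z) \<zz> \<le> (SUP \<yy>\<in>T Y. xiT Y \<phi> \<yy> \<otimes> Txi Y Z s \<yy> \<zz>)"
proof -
  let ?P = "uprod Y Z"
  have eq: "xiT Z (\<lambda>z. SUP y\<in>Y. \<phi> y \<otimes> s y z)
      = xiT Z (\<lambda>z. SUP p\<in>{p \<in> ?P. pi2 p = z}. \<phi> (pi1 p) \<otimes> s (pi1 p) (pi2 p))"
  proof (rule xiT_cong, rule antisym)
    fix z assume z: "z \<in> Z"
    show "(SUP y\<in>Y. \<phi> y \<otimes> s y z) \<le> (SUP p\<in>{p \<in> ?P. pi2 p = z}. \<phi> (pi1 p) \<otimes> s (pi1 p) (pi2 p))"
    proof (rule SUP_least)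
      fix y assume "y \<in> Y"
      with z show "\<phi> y \<otimes> s y z \<le> (SUP p\<in>{p \<in> ?P. pi2 p = z}. \<phi> (pi1 p) \<otimes> s (pi1 p) (pi2 p))"
        by (intro SUP_upper2[of "opair y z"]) auto
    qed
    show "(SUP p\<in>{p \<in> ?P. pi2 p = z}. \<phi> (pi1 p) \<otimes> s (pi1 p) (pi2 p)) \<le> (SUP y\<in>Y. \<phi> y \<otimes> s y z)"
      by (auto intro!: SUP_least SUP_upper2[of "pi1 _"])
  qed
  have "xiT Z (\<lambda>z. SUP y\<in>Y. \<phi> y \<otimes> s y z) \<zz>
      = (SUP \<ww>\<in>{\<ww> \<in> T ?P. Mr ?P Z pi2 \<ww> = \<zz>}. xiT ?P (\<lambda>p. \<phi> (pi1 p) \<otimes> s (pi1 p) (pi2 p)) \<ww>)"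
    unfolding eq by (rule xiT_pushforward) (use S z in auto)
  also have "\<dots> \<le> (SUP \<yy>\<in>T Y. xiT Y \<phi> \<yy> \<otimes> Txi Y Z s \<yy> \<zz>)"
  proof (rule SUP_least)
    fix \<ww> assume w: "\<ww> \<in> {\<ww> \<in> T ?P. Mr ?P Z pi2 \<ww> = \<zz>}"
    let ?y = "Mr ?P Y pi1 \<ww>"
    have "xiT ?P (\<lambda>p. \<phi> (pi1 p) \<otimes> s (pi1 p) (pi2 p)) \<ww>
        = xiT Y \<phi> ?y \<otimes> xiT ?P (\<lambda>p. s (pi1 p) (pi2 p)) \<ww>"
      using S w by (simp add: xiT_tensor xiT_Mr)
    also have "\<dots> \<le> xiT Y \<phi> ?y \<otimes> Txi Y Z s ?y \<zz>"
      using S w by (intro tensor_mono Txi_upper) auto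
    also have "\<dots> \<le> (SUP \<yy>\<in>T Y. xiT Y \<phi> \<yy> \<otimes> Txi Y Z s \<yy> \<zz>)"
      using S w by (intro SUP_upper) auto
    finally show "xiT ?P (\<lambda>p. \<phi> (pi1 p) \<otimes> s (pi1 p) (pi2 p)) \<ww>
      \<le> (SUP \<yy>\<in>T Y. xiT Y \<phi> \<yy> \<otimes> Txi Y Z s \<yy> \<zz>)" .
  qed
  finally show ?thesis .
qed

text \<open>
  Elements of \<open>T(X \<times> Y)\<close> and \<open>T(Y \<times> Z)\<close> over the same \<open>\<yy>\<close> have a common lift to \<open>T(X \<times> Y \<times> Z)\<close>, as
  \<open>X \<times> Y \<times> Z\<close> is the pullback of the projections to \<open>Y\<close> and \<open>T\<close> preserves weak pullbacks.
\<close>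

lemma Txi_tensor_le:
  assumes S: "small X" "small Y" "small Z" 
  shows "Txi X Y r \<xx> \<yy> \<otimes> Txi Y Z s \<yy> \<zz> \<le> Txi X Z (vcomp s r) \<xx> \<zz>"
proof -
  let ?P = "uprod (uprod X Y) Z"
  let ?A = "{w \<in> T (uprod X Y). Mr (uprod X Y) X pi1 w = \<xx> \<and> Mr (uprod X Y) Y pi2 w = \<yy>}"
  let ?B = "{w \<in> T (uprod Y Z). Mr (uprod Y Z) Y pi1 w = \<yy> \<and> Mr (uprod Y Z) Z pi2 w = \<zz>}"
  let ?r = "\<lambda>p. r (pi1 p) (pi2 p)" and ?s = "\<lambda>p. s (pi1 p) (pi2 p)"
  have le: "xiT (uprod X Y) ?r u \<otimes> xiT (uprod Y Z) ?s v \<le> Txi X Z (vcomp s r) \<xx> \<zz>"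
    if u: "u \<in> ?A" and v: "v \<in> ?B" for u v
  proof -
    let ?q = "\<lambda>p. opair (pi2 (pi1 p)) (pi2 p)"
    obtain w where w: "w \<in> T ?P" "Mr ?P (uprod X Y) pi1 w = u" "Mr ?P (uprod Y Z) ?q w = v"
    proof (rule T_lift[of ?P "uprod X Y" "uprod Y Z" Y pi1 ?q pi2 pi1 u v])
      fix a b assume "a \<in> uprod X Y" "b \<in> uprod Y Z" "pi2 a = pi1 b"
      then show "\<exists>z\<in>?P. pi1 z = a \<and> ?q z = b"
        by (intro bexI[of _ "opair a (pi2 b)"]) (auto simp: uprod_def)
    qed (use S u v in auto)
    have q: "?q \<in> ?P \<rightarrow> uprod Y Z" by auto
    have "xiT (uprod X Y) ?r u \<otimes> xiT (uprod Y Z) ?s v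
        = xiT ?P (\<lambda>p. r (pi1 (pi1 p)) (pi2 (pi1 p)) \<otimes> s (pi2 (pi1 p)) (pi2 p)) w"
      using S w q by (simp add: xiT_tensor xiT_Mr flip: w(2,3))
    also have "\<dots> \<le> xiT ?P (\<lambda>p. vcomp s r (pi1 (pi1 p)) (pi2 p)) w"
      using S w by (intro xiT_mono vcomp_upper) auto
    also have "\<dots> \<le> Txi X Z (vcomp s r) \<xx> \<zz>"
    proof (rule Txi_upper)
      have "Mr ?P X (\<lambda>p. pi1 (pi1 p)) w = Mr (uprod X Y) X pi1 (Mr ?P (uprod X Y) pi1 w)"
        using S w by (subst Mr_Mr) auto
      then show "Mr ?P X (\<lambda>p. pi1 (pi1 p)) w = \<xx>" using w u by simp
      have "Mr ?P Z pi2 w = Mr (uprod Y Z) Z pi2 (Mr ?P (uprod Y Z) ?q w)"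
        using S w q by (subst Mr_Mr) auto
      then show "Mr ?P Z pi2 w = \<zz>" using w v by simp
    qed (use S w in auto)
    finally show ?thesis .
  qed
  have eq: "Txi X Y r \<xx> \<yy> = (SUP u\<in>?A. xiT (uprod X Y) ?r u)"
       "Txi Y Z s \<yy> \<zz> = (SUP v\<in>?B. xiT (uprod Y Z) ?s v)"
    by (auto simp: Txi_def intro!: arg_cong[of _ _ Sup])
  show ?thesis unfolding eq SUP_tensor tensor_SUP
    by (intro SUP_least le)
qed

text \<open>
  One inequality lifts along a weak pullback. For the other one, \<open>s \<cdot> r\<close> is the supremum of the
  function \<open>r(x, y) \<otimes> s(y, z)\<close> along the projection \<open>X \<times> Y \<times> Z \<rightarrow> X \<times> Z\<close>.
\<close>

lemma Txi_vcomp: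
  assumes S: "small X" "small Y" "small Z" and r: "r \<in> vrel X Y"
  shows "Txi X Z (vcomp s r) = vcomp (Txi Y Z s) (Txi X Y r)"
proof (rule antisym; rule le_funI; rule le_funI)
  fix \<xx> \<zz>
  show "vcomp (Txi Y Z s) (Txi X Y r) \<xx> \<zz> \<le> Txi X Z (vcomp s r) \<xx> \<zz>"
    using S by (intro vcomp_least Txi_tensor_le)
  let ?P = "uprod (uprod X Y) Z"
  let ?h = "\<lambda>p. opair (pi1 (pi1 p)) (pi2 p)"
  let ?R = "\<lambda>p. r (pi1 (pi1 p)) (pi2 (pi1 p))" and ?S = "\<lambda>p. s (pi2 (pi1 p)) (pi2 p)"
  have h: "?h \<in> ?P \<rightarrow> uprod X Z" by auto
  have eq: "xiT (uprod X Z) (\<lambda>q. vcomp s r (pi1 q) (pi2 q))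
      = xiT (uprod X Z) (\<lambda>q. SUP p\<in>{p \<in> ?P. ?h p = q}. ?R p \<otimes> ?S p)"
  proof (rule xiT_cong, rule antisym)
    fix q assume q: "q \<in> uprod X Z"
    show "vcomp s r (pi1 q) (pi2 q) \<le> (SUP p\<in>{p \<in> ?P. ?h p = q}. ?R p \<otimes> ?S p)"
    proof (rule vcomp_leastI[OF r])
      fix y assume "y \<in> Y"
      with q show "r (pi1 q) y \<otimes> s y (pi2 q) \<le> (SUP p\<in>{p \<in> ?P. ?h p = q}. ?R p \<otimes> ?S p)"
        by (intro SUP_upper2[of "opair (opair (pi1 q) y) (pi2 q)"]) auto
    qed
    show "(SUP p\<in>{p \<in> ?P. ?h p = q}. ?R p \<otimes> ?S p) \<le> vcomp s r (pi1 q) (pi2 q)"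
      by (auto intro!: SUP_least vcomp_upper)
  qed
  show "Txi X Z (vcomp s r) \<xx> \<zz> \<le> vcomp (Txi Y Z s) (Txi X Y r) \<xx> \<zz>"
  proof (rule Txi_least)
    fix \<ww> assume w: "\<ww> \<in> T (uprod X Z)" "Mr (uprod X Z) X pi1 \<ww> = \<xx>" "Mr (uprod X Z) Z pi2 \<ww> = \<zz>"
    have "xiT (uprod X Z) (\<lambda>p. vcomp s r (pi1 p) (pi2 p)) \<ww>
        = (SUP u\<in>{u \<in> T ?P. Mr ?P (uprod X Z) ?h u = \<ww>}. xiT ?P (\<lambda>p. ?R p \<otimes> ?S p) u)"
      unfolding eq by (rule xiT_pushforward) (use S w h in auto)
    also have "\<dots> \<le> vcomp (Txi Y Z s) (Txi X Y r) \<xx> \<zz>"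
    proof (rule SUP_least)
      fix u assume u: "u \<in> {u \<in> T ?P. Mr ?P (uprod X Z) ?h u = \<ww>}"
      let ?y = "Mr ?P Y (\<lambda>p. pi2 (pi1 p)) u"
      have x: "Mr ?P X (\<lambda>p. pi1 (pi1 p)) u = \<xx>" and z: "Mr ?P Z pi2 u = \<zz>"
        using S u w h by (auto simp: Mr_Mr)
      have "xiT ?P (\<lambda>p. ?R p \<otimes> ?S p) u = xiT ?P ?R u \<otimes> xiT ?P ?S u"
        using S u by (simp add: xiT_tensor)
      also have "\<dots> \<le> Txi X Y r \<xx> ?y \<otimes> Txi Y Z s ?y \<zz>"
        using S u x z by (intro tensor_mono Txi_upper) auto
      also have "\<dots> \<le> vcomp (Txi Y Z s) (Txi X Y r) \<xx> \<zz>" by (rule vcomp_upper)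
      finally show "xiT ?P (\<lambda>p. ?R p \<otimes> ?S p) u \<le> vcomp (Txi Y Z s) (Txi X Y r) \<xx> \<zz>" .
    qed
    finally show "xiT (uprod X Z) (\<lambda>p. vcomp s r (pi1 p) (pi2 p)) \<ww>
      \<le> vcomp (Txi Y Z s) (Txi X Y r) \<xx> \<zz>" .
  qed
qed

text \<open>
  Precomposition with a map: the square formed by \<open>f \<times> Z\<close>, \<open>f\<close> and the first projections is a pullback.
\<close>

lemma Txi_Mr:
  assumes S: "small X" "small Y" "small Z" and f: "f \<in> X \<rightarrow> Y" and x: "\<xx> \<in> T X"
  shows "Txi Y Z s (Mr X Y f \<xx>) \<zz> = Txi X Z (\<lambda>x. s (f x)) \<xx> \<zz>"
proof (rule antisym; rule Txi_least)
  let ?h = "\<lambda>p. opair (f (pi1 p)) (pi2 p)"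
  have h: "?h \<in> uprod X Z \<rightarrow> uprod Y Z" using f by auto
  {
    fix \<ww> assume w: "\<ww> \<in> T (uprod Y Z)" "Mr (uprod Y Z) Y pi1 \<ww> = Mr X Y f \<xx>"
      "Mr (uprod Y Z) Z pi2 \<ww> = \<zz>"
    obtain u where u: "u \<in> T (uprod X Z)" "Mr (uprod X Z) X pi1 u = \<xx>"
        "Mr (uprod X Z) (uprod Y Z) ?h u = \<ww>"
    proof (rule T_lift[of "uprod X Z" X "uprod Y Z" Y pi1 ?h f pi1 \<xx> \<ww>])
      fix a b assume "a \<in> X" "b \<in> uprod Y Z" "f a = pi1 b"
      then show "\<exists>z\<in>uprod X Z. pi1 z = a \<and> ?h z = b"
        by (intro bexI[of _ "opair a (pi2 b)"]) (auto simp: uprod_def)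
    qed (use S f x w in auto)
    have "xiT (uprod Y Z) (\<lambda>p. s (pi1 p) (pi2 p)) \<ww>
        = xiT (uprod X Z) (\<lambda>p. s (f (pi1 p)) (pi2 p)) u"
      using S h u by (simp add: xiT_Mr flip: u(3))
    also have "\<dots> \<le> Txi X Z (\<lambda>x. s (f x)) \<xx> \<zz>"
    proof (rule Txi_upper)
      have "Mr (uprod X Z) Z pi2 u = Mr (uprod Y Z) Z pi2 (Mr (uprod X Z) (uprod Y Z) ?h u)"
        using S h u by (subst Mr_Mr) auto
      then show "Mr (uprod X Z) Z pi2 u = \<zz>" using w u by simp
    qed (use S u in auto)
    finally show "xiT (uprod Y Z) (\<lambda>p. s (pi1 p) (pi2 p)) \<ww> \<le> Txi X Z (\<lambda>x. s (f x)) \<xx> \<zz>" .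
  next
    fix \<ww> assume w: "\<ww> \<in> T (uprod X Z)" "Mr (uprod X Z) X pi1 \<ww> = \<xx>"
      "Mr (uprod X Z) Z pi2 \<ww> = \<zz>"
    have "Mr (uprod X Z) Y (\<lambda>p. f (pi1 p)) \<ww> = Mr X Y f (Mr (uprod X Z) X pi1 \<ww>)"
      using S f w(1) by (subst Mr_Mr) auto
    then show "xiT (uprod X Z) (\<lambda>p. s (f (pi1 p)) (pi2 p)) \<ww> \<le> Txi Y Z s (Mr X Y f \<xx>) \<zz>"
      using S w f by (intro Txi_upper) auto
  }
qed

text \<open>
  The relation \<open>T\<^sub>\<xi> r\<close> on \<open>T X \<times> T Y\<close> is the supremum of \<open>\<xi> \<cdot> T r\<close> along the canonical map
  \<open>T(X \<times> Y) \<rightarrow> T X \<times> T Y\<close>. Hence an element of \<open>T(T X \<times> T Y)\<close> can be replaced by elements of \<open>T T(X \<times> Y)\<close>,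
  and \<open>m\<close> maps these to \<open>T(X \<times> Y)\<close>.
\<close>

lemma Txi_m:
  assumes S: "small X" "small Y" and "\<XX> \<in> T (T X)" "\<YY> \<in> T (T Y)"
  shows "Txi (T X) (T Y) (Txi X Y r) \<XX> \<YY> \<le> Txi X Y r (m X \<XX>) (m Y \<YY>)"
proof (rule Txi_least)
  let ?P = "uprod X Y" and ?Q = "uprod (T X) (T Y)"
  let ?c = "\<lambda>\<ww>. opair (Mr ?P X pi1 \<ww>) (Mr ?P Y pi2 \<ww>)"
  let ?r = "\<lambda>p. r (pi1 p) (pi2 p)"
  have c: "?c \<in> T ?P \<rightarrow> ?Q" using S by auto
  fix W assume W: "W \<in> T ?Q" "Mr ?Q (T X) pi1 W = \<XX>" "Mr ?Q (T Y) pi2 W = \<YY>"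
  have "xiT ?Q (\<lambda>q. Txi X Y r (pi1 q) (pi2 q)) W
      = xiT ?Q (\<lambda>q. SUP \<ww>\<in>{\<ww> \<in> T ?P. ?c \<ww> = q}. xiT ?P ?r \<ww>) W"
    unfolding Txi_def
    by (rule xiT_cong[THEN fun_cong], rule arg_cong[of _ _ Sup]) (force simp: uprod_def)
  also have "\<dots> = (SUP \<Omega>\<in>{\<Omega> \<in> T (T ?P). Mr (T ?P) ?Q ?c \<Omega> = W}. xiT (T ?P) (xiT ?P ?r) \<Omega>)"
    using S W c by (intro xiT_pushforward) auto
  also have "\<dots> \<le> Txi X Y r (m X \<XX>) (m Y \<YY>)"
  proof (rule SUP_least)
    fix \<Omega> assume O: "\<Omega> \<in> {\<Omega> \<in> T (T ?P). Mr (T ?P) ?Q ?c \<Omega> = W}"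
    have O': "Mr (T ?P) ?Q ?c \<Omega> = W" using O by simp
    have x: "Mr ?P X pi1 (m ?P \<Omega>) = m X \<XX>"
    proof -
      have "Mr ?P X pi1 (m ?P \<Omega>) = m X (Mr (T ?P) (T X) (Mr ?P X pi1) \<Omega>)"
        using S O by (subst m_Mr) auto
      also have "Mr (T ?P) (T X) (Mr ?P X pi1) \<Omega> = Mr ?Q (T X) pi1 (Mr (T ?P) ?Q ?c \<Omega>)"
        using S O c by (subst Mr_Mr) auto
      finally show ?thesis by (simp only: O' W)
    qed
    have y: "Mr ?P Y pi2 (m ?P \<Omega>) = m Y \<YY>"
    proof -
      have "Mr ?P Y pi2 (m ?P \<Omega>) = m Y (Mr (T ?P) (T Y) (Mr ?P Y pi2) \<Omega>)"
        using S O by (subst m_Mr) auto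
      also have "Mr (T ?P) (T Y) (Mr ?P Y pi2) \<Omega> = Mr ?Q (T Y) pi2 (Mr (T ?P) ?Q ?c \<Omega>)"
        using S O c by (subst Mr_Mr) auto
      finally show ?thesis by (simp only: O' W)
    qed
    have "xiT (T ?P) (xiT ?P ?r) \<Omega> = xiT ?P ?r (m ?P \<Omega>)"
      using S O by (simp add: xiT_m)
    also have "\<dots> \<le> Txi X Y r (m X \<XX>) (m Y \<YY>)"
      using S O x y by (intro Txi_upper) auto
    finally show "xiT (T ?P) (xiT ?P ?r) \<Omega> \<le> Txi X Y r (m X \<XX>) (m Y \<YY>)" .
  qed
  finally show "xiT ?Q (\<lambda>q. Txi X Y r (pi1 q) (pi2 q)) W \<le> Txi X Y r (m X \<XX>) (m Y \<YY>)" .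
qed

text \<open>
  Together with \<open>Txi_m\<close> this is strict naturality of \<open>m\<close> with respect to relations. The naturality square of \<open>m\<close>
  at the projection \<open>X \<times> Y \<rightarrow> X\<close> is a weak pullback, so an element of \<open>T(X \<times> Y)\<close> over \<open>m(\<XX>)\<close> comes from one of
  \<open>T T(X \<times> Y)\<close> over \<open>\<XX>\<close>.
\<close>

lemma Txi_m_le:
  assumes S: "small X" "small Y" and X: "\<XX> \<in> T (T X)"
  shows "Txi X Y r (m X \<XX>) \<yy> \<le> (SUP \<YY>\<in>{\<YY> \<in> T (T Y). m Y \<YY> = \<yy>}. Txi (T X) (T Y) (Txi X Y r) \<XX> \<YY>)"
proof (rule Txi_least)
  let ?P = "uprod X Y"
  let ?r = "\<lambda>p. r (pi1 p) (pi2 p)"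
  fix \<ww> assume w: "\<ww> \<in> T ?P" "Mr ?P X pi1 \<ww> = m X \<XX>" "Mr ?P Y pi2 \<ww> = \<yy>"
  obtain \<Omega> where O: "\<Omega> \<in> T (T ?P)" "m ?P \<Omega> = \<ww>" "Mr (T ?P) (T X) (Mr ?P X pi1) \<Omega> = \<XX>"
    using S X w by (elim m_lift[of ?P X pi1 \<ww> \<XX>, rotated -1]) auto
  let ?Y = "Mr (T ?P) (T Y) (Mr ?P Y pi2) \<Omega>"
  have Y: "?Y \<in> T (T Y)" "m Y ?Y = \<yy>" using S O w by (auto simp: m_Mr)
  have "xiT ?P ?r \<ww> = xiT (T ?P) (xiT ?P ?r) \<Omega>" using S O by (simp add: xiT_m flip: O(2))
  also have "\<dots> \<le> xiT (T ?P) (\<lambda>\<ww>. Txi X Y r (Mr ?P X pi1 \<ww>) (Mr ?P Y pi2 \<ww>)) \<Omega>"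
    using S O by (intro xiT_mono Txi_upper) auto
  also have "\<dots> \<le> Txi (T X) (T Y) (Txi X Y r) \<XX> ?Y"
    using S O by (intro Txi_upper) auto
  also have "\<dots> \<le> (SUP \<YY>\<in>{\<YY> \<in> T (T Y). m Y \<YY> = \<yy>}. Txi (T X) (T Y) (Txi X Y r) \<XX> \<YY>)"
    using Y by (intro SUP_upper) auto
  finally show "xiT ?P ?r \<ww> \<le> \<dots>" .
qed

text \<open>
  The element \<open>e(p)\<close> is the image of a point of \<open>T 1\<close>, so that \<open>Txi_Mr\<close> reduces the claim to a relation from
  the one-point set to \<open>Y\<close>.
\<close>

lemma Txi_point_le:
  assumes S: "small P" "small Y" and p: "p \<in> P"
  shows "Txi P Y r (e P p) \<yy> \<le> xiT Y (r p) \<yy>"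
proof -
  have "e P p = Mr one P (\<lambda>_. p) (e one (code {}))"
    using S p by (subst e_Mr) (auto simp: one_def)
  then have "Txi P Y r (e P p) \<yy> = Txi one Y (\<lambda>_. r p) (e one (code {})) \<yy>"
    using S p by (simp add: Txi_Mr one_def)
  also have "\<dots> \<le> xiT Y (r p) \<yy>"
  proof (rule Txi_least)
    fix \<ww> assume "\<ww> \<in> T (uprod one Y)" "Mr (uprod one Y) Y pi2 \<ww> = \<yy>"
    then show "xiT (uprod one Y) (\<lambda>q. r p (pi2 q)) \<ww> \<le> xiT Y (r p) \<yy>"
      using S by (auto simp: xiT_Mr)
  qed
  finally show ?thesis .
qed

text \<open>
  The fibre of \<open>r\<close> over a point, as a function, and its extension as a relation agree. For the remaining
  inequality, the image of \<open>\<yy>\<close> under \<open>y \<mapsto> (p, y)\<close> is a witness: it lies over \<open>e(p)\<close>, since \<open>T\<close> of the constant map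
  with value \<open>p\<close> factors through \<open>T 1 = 1\<close>.
\<close>

lemma Txi_point:
  assumes T1: "is_singleton (T one)" and S: "small P" "small Y" and p: "p \<in> P" and y: "\<yy> \<in> T Y"
  shows "Txi P Y r (e P p) \<yy> = xiT Y (r p) \<yy>"
proof (rule antisym[OF Txi_point_le[OF S p]])
  have c: "(\<lambda>_. code {}) \<in> Y \<rightarrow> one" "(\<lambda>_. p) \<in> one \<rightarrow> P" using p by (auto simp: one_def)
  then have "Mr Y one (\<lambda>_. code {}) \<yy> \<in> T one" "e one (code {}) \<in> T one"
    using S y by (auto simp: one_def)
  with T1 have "Mr Y one (\<lambda>_. code {}) \<yy> = e one (code {})"
    by (auto simp: is_singleton_def)
  then have "Mr one P (\<lambda>_. p) (Mr Y one (\<lambda>_. code {}) \<yy>) = e P p"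
    using S c by (simp add: e_Mr one_def)
  then have "Mr Y P (\<lambda>_. p) \<yy> = e P p"
    using S c y by (simp add: Mr_Mr)
  then show "xiT Y (r p) \<yy> \<le> Txi P Y r (e P p) \<yy>"
    using S p y by (intro Txi_upper) (auto simp: Mr_id)
qed

section \<open>Categories over the theory\<close>

lemma TcategoryD:
  assumes "Tcategory (X, a)"
  shows Tcat_small: "small X" and Tcat_vrel: "a \<in> vrel (T X) X"
    and Tcat_refl: "x \<in> X \<Longrightarrow> k \<le> a (e X x) x"
    and Tcat_trans: "\<XX> \<in> T (T X) \<Longrightarrow> Txi (T X) X a \<XX> \<xx> \<otimes> a \<xx> x \<le> a (m X \<XX>) x"
proof -
  from assms show "small X" "a \<in> vrel (T X) X" by (auto simp: Tcategory_def)
  from assms have r: "vconv (vgraph X (e X)) \<le> a"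
    and t: "vcomp (vcomp a (Txi (T X) X a)) (vconv (vgraph (T (T X)) (m X))) \<le> a"
    by (auto simp: Tcategory_def)
  show "k \<le> a (e X x) x" if "x \<in> X"
    using le_funD[OF le_funD[OF r, of "e X x"], of x] that by (simp add: vconv_def vgraph_def)
  show "Txi (T X) X a \<XX> \<xx> \<otimes> a \<xx> x \<le> a (m X \<XX>) x" if "\<XX> \<in> T (T X)"
  proof -
    have "Txi (T X) X a \<XX> \<xx> \<otimes> a \<xx> x \<le> vcomp a (Txi (T X) X a) \<XX> x" by (rule vcomp_upper)
    also have "\<dots> \<le> vcomp (vcomp a (Txi (T X) X a)) (vconv (vgraph (T (T X)) (m X))) (m X \<XX>) x"
      unfolding vcomp_vconv_vgraph using that by (intro SUP_upper) auto
    also have "\<dots> \<le> a (m X \<XX>) x" using t by (simp add: le_fun_def)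
    finally show ?thesis .
  qed
qed

lemma TcategoryI:
  assumes "small X" "a \<in> vrel (T X) X" and r: "\<And>x. x \<in> X \<Longrightarrow> k \<le> a (e X x) x"
    and t: "\<And>\<XX> \<xx> x. \<XX> \<in> T (T X) \<Longrightarrow> \<xx> \<in> T X \<Longrightarrow> x \<in> X
      \<Longrightarrow> Txi (T X) X a \<XX> \<xx> \<otimes> a \<xx> x \<le> a (m X \<XX>) x"
  shows "Tcategory (X, a)"
proof -
  have "vconv (vgraph X (e X)) \<le> a"
    using r by (auto simp: le_fun_def vconv_def vgraph_def)
  moreover have "vcomp (vcomp a (Txi (T X) X a)) (vconv (vgraph (T (T X)) (m X))) \<le> a"
  proof (intro le_funI)
    fix \<yy> x
    have "Txi (T X) X a \<XX> \<xx> \<otimes> a \<xx> x \<le> a (m X \<XX>) x" if "\<XX> \<in> T (T X)" for \<XX> \<xx>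
    proof (cases "\<xx> \<in> T X \<and> x \<in> X")
      case False
      then have "a \<xx> x = bot" using assms(2) by (auto simp: vrel_def)
      then show ?thesis by simp
    qed (use t that in auto)
    then show "vcomp (vcomp a (Txi (T X) X a)) (vconv (vgraph (T (T X)) (m X))) \<yy> x \<le> a \<yy> x"
      unfolding vcomp_vconv_vgraph by (auto intro!: SUP_least vcomp_least)
  qed
  ultimately show ?thesis using assms by (simp add: Tcategory_def)
qed

lemma under_pair: "under (X, a) x y = (if x \<in> X then a (e X x) y else bot)"
  by (simp add: under_def vcomp_vgraph)

lemma snd_Tcat_T: "\<XX> \<in> T (T X) \<Longrightarrow>
    snd (Tcat_T (X, a)) \<XX> \<xx> = (SUP \<YY>\<in>{\<YY> \<in> T (T X). m X \<YY> = m X \<XX>}. Txi (T X) X a \<YY> \<xx>)"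
  by (simp add: Tcat_T_def vcomp_vgraph vcomp_vconv_vgraph)

lemma fst_Tcat_T [simp]: "fst (Tcat_T (X, a)) = T X"
  by (simp add: Tcat_T_def)

lemma under_Tcat_T:
  assumes "small X" "\<xx> \<in> T X"
  shows "under (Tcat_T (X, a)) \<xx> \<yy> = (SUP \<YY>\<in>{\<YY> \<in> T (T X). m X \<YY> = \<xx>}. Txi (T X) X a \<YY> \<yy>)"
proof -
  have "under (Tcat_T (X, a)) \<xx> \<yy> = snd (Tcat_T (X, a)) (e (T X) \<xx>) \<yy>"
    using assms under_pair[of "T X" "snd (Tcat_T (X, a))" \<xx> \<yy>] fst_Tcat_T[of X a]
    by (metis prod.collapse)
  then show ?thesis using assms by (simp add: snd_Tcat_T m_e_T)
qed

lemma Tfunctor_iff: "Tfunctor A B f \<longleftrightarrow> f \<in> fst A \<rightarrow>\<^sub>E fst B \<and>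
    (\<forall>\<xx>\<in>T (fst A). \<forall>x\<in>fst A. snd A \<xx> x \<le> snd B (M (fst A) (fst B) f \<xx>) (f x))"
  by (cases A; cases B) (simp add: Tfunctor_def)

lemma Tcat_comp_under:
  assumes A: "Tcategory (X, a)" and "\<xx> \<in> T X"
  shows "a \<xx> x \<otimes> under (X, a) x y \<le> a \<xx> y"
proof (cases "x \<in> X")
  case True
  note S = Tcat_small[OF A]
  have "a \<xx> x \<otimes> under (X, a) x y \<le> Txi (T X) X a (e (T X) \<xx>) (e X x) \<otimes> a (e X x) y"
    using S True assms by (intro tensor_mono Txi_e) (auto simp: under_pair)
  also have "\<dots> \<le> a (m X (e (T X) \<xx>)) y"
    using S True assms by (intro Tcat_trans[OF A]) auto
  finally show ?thesis using S assms by (simp add: m_e_T)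
qed (simp add: under_pair)

lemma under_refl: "Tcategory (X, a) \<Longrightarrow> x \<in> X \<Longrightarrow> k \<le> under (X, a) x x"
  by (simp add: under_pair Tcat_refl)

text \<open>
  By \<open>Txi_Mr\<close> the value is that of \<open>T\<^sub>\<xi>(a\<^sub>0)\<close> at \<open>(\<xx>, \<xx>)\<close>, and \<open>a\<^sub>0\<close> is reflexive.
\<close>

lemma Txi_Te_refl:
  assumes A: "Tcategory (X, a)" and "\<xx> \<in> T X"
  shows "k \<le> Txi (T X) X a (Mr X (T X) (e X) \<xx>) \<xx>"
proof -
  note S = Tcat_small[OF A]
  have "k \<le> Txi X X (\<lambda>x. a (e X x)) \<xx> (Mr X X (\<lambda>x. x) \<xx>)"
    using S assms Tcat_refl[OF A] by (intro k_le_Txi_graph) auto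
  then show ?thesis using S assms by (subst Txi_Mr) (auto simp: Mr_id)
qed

lemma le_under_Tcat_T:
  assumes A: "Tcategory (X, a)" and "\<xx> \<in> T X" "x \<in> X"
  shows "a \<xx> x \<le> under (Tcat_T (X, a)) \<xx> (e X x)"
proof -
  note S = Tcat_small[OF A]
  have "a \<xx> x \<le> Txi (T X) X a (e (T X) \<xx>) (e X x)"
    using S assms by (intro Txi_e) auto
  also have "\<dots> \<le> under (Tcat_T (X, a)) \<xx> (e X x)"
    using S assms by (subst under_Tcat_T) (auto intro!: SUP_upper simp: m_e_T)
  finally show ?thesis .
qed

lemma under_Tcat_T_comp:
  assumes A: "Tcategory (X, a)" and "\<xx> \<in> T X"
  shows "under (Tcat_T (X, a)) \<xx> \<yy> \<otimes> a \<yy> y \<le> a \<xx> y"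
  using Tcat_trans[OF A] assms(2)
  by (auto simp: under_Tcat_T[OF Tcat_small[OF A]] SUP_tensor intro!: SUP_least)

text \<open>
  The element \<open>T e(m(\<XX>))\<close> has the same image under \<open>m\<close> as \<open>\<XX>\<close>, so \<open>Txi_Te_refl\<close> applies.
\<close>

lemma Tcat_T_m:
  assumes A: "Tcategory (X, a)" and "\<XX> \<in> T (T X)"
  shows "k \<le> snd (Tcat_T (X, a)) \<XX> (m X \<XX>)"
proof -
  note S = Tcat_small[OF A]
  have "k \<le> Txi (T X) X a (Mr X (T X) (e X) (m X \<XX>)) (m X \<XX>)"
    using S assms by (intro Txi_Te_refl) auto
  also have "\<dots> \<le> snd (Tcat_T (X, a)) \<XX> (m X \<XX>)"
    using S assms by (subst snd_Tcat_T) (auto intro!: SUP_upper simp: m_T_e)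
  finally show ?thesis .
qed

lemma restrict_e: "small X \<Longrightarrow> restrict (e X) X = e X"
  using e_map[of X] by (auto simp: PiE_restrict)

lemma e_Tfunctor:
  assumes A: "Tcategory (X, a)"
  shows "Tfunctor (X, a) (Tcat_T (X, a)) (e X)"
proof -
  note S = Tcat_small[OF A]
  have "a \<xx> x \<le> snd (Tcat_T (X, a)) (M X (T X) (e X) \<xx>) (e X x)" if "\<xx> \<in> T X" "x \<in> X" for \<xx> x
  proof -
    have Te: "Mr X (T X) (e X) \<xx> \<in> T (T X)" using S that by auto
    have "a \<xx> x \<le> Txi (T X) X a (e (T X) \<xx>) (e X x)"
      using S that by (intro Txi_e) auto
    also have "\<dots> \<le> snd (Tcat_T (X, a)) (Mr X (T X) (e X) \<xx>) (e X x)"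
      using S that Te by (subst snd_Tcat_T) (auto intro!: SUP_upper simp: m_T_e m_e_T)
    finally show ?thesis using S by (simp add: restrict_e)
  qed
  then show ?thesis using S e_map[of X] by (simp add: Tfunctor_iff)
qed

section \<open>Representable categories\<close>

lemma repr_adjointD:
  assumes "repr_adjoint (X, a) \<alpha>"
  shows "\<alpha> \<in> T X \<rightarrow>\<^sub>E X"
    and "\<XX> \<in> T (T X) \<Longrightarrow> \<xx> \<in> T X \<Longrightarrow> snd (Tcat_T (X, a)) \<XX> \<xx> \<le> a (Mr (T X) X \<alpha> \<XX>) (\<alpha> \<xx>)"
    and "\<xx> \<in> T X \<Longrightarrow> k \<le> under (Tcat_T (X, a)) \<xx> (e X (\<alpha> \<xx>))"
    and "x \<in> X \<Longrightarrow> k \<le> under (X, a) (\<alpha> (e X x)) x"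
proof -
  from assms show a: "\<alpha> \<in> T X \<rightarrow>\<^sub>E X"
    by (simp add: repr_adjoint_def adjoint_def Tfunctor_iff)
  then have r: "restrict \<alpha> (T X) = \<alpha>" by (rule PiE_restrict)
  show "snd (Tcat_T (X, a)) \<XX> \<xx> \<le> a (Mr (T X) X \<alpha> \<XX>) (\<alpha> \<xx>)" if "\<XX> \<in> T (T X)" "\<xx> \<in> T X"
    using assms that by (simp add: r repr_adjoint_def adjoint_def Tfunctor_iff)
  show "k \<le> under (Tcat_T (X, a)) \<xx> (e X (\<alpha> \<xx>))" if "\<xx> \<in> T X"
    using assms that by (simp add: repr_adjoint_def adjoint_def map_le_def compose_def)
  show "k \<le> under (X, a) (\<alpha> (e X x)) x" if "x \<in> X"
    using assms that by (simp add: repr_adjoint_def adjoint_def map_le_def compose_def)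
qed

text \<open>
  In a representable category the structure is \<open>a\<^sub>0 \<cdot> \<alpha>\<close>. Since \<open>\<alpha>\<close> is a functor, it sends \<open>a(\<xx>, x)\<close>, which is
  bounded by the structure of \<open>T X\<close> at \<open>(\<xx>, e(x))\<close>, into \<open>a\<^sub>0(\<alpha>(\<xx>), \<alpha>(e(x)))\<close>, and \<open>\<alpha> \<cdot> e \<le> 1\<close>. The converse uses
  \<open>1 \<le> e \<cdot> \<alpha>\<close>.
\<close>

lemma repr_adjoint_eq:
  assumes A: "Tcategory (X, a)" and ad: "repr_adjoint (X, a) \<alpha>" and x: "\<xx> \<in> T X"
  shows "a \<xx> x = under (X, a) (\<alpha> \<xx>) x"
proof (rule antisym)
  note S = Tcat_small[OF A]
  have al: "\<alpha> \<xx> \<in> X" using repr_adjointD(1)[OF ad] x by auto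
  show "a \<xx> x \<le> under (X, a) (\<alpha> \<xx>) x"
  proof (cases "x \<in> X")
    case True
    have "a \<xx> x \<le> under (Tcat_T (X, a)) \<xx> (e X x)"
      using A x True by (rule le_under_Tcat_T)
    also have "\<dots> = snd (Tcat_T (X, a)) (e (T X) \<xx>) (e X x)"
      using S x by (simp add: under_Tcat_T snd_Tcat_T m_e_T)
    also have "\<dots> \<le> a (Mr (T X) X \<alpha> (e (T X) \<xx>)) (\<alpha> (e X x))"
      using S x True by (intro repr_adjointD[OF ad]) auto
    also have "Mr (T X) X \<alpha> (e (T X) \<xx>) = e X (\<alpha> \<xx>)"
      using S x repr_adjointD(1)[OF ad] by (intro e_Mr) auto
    finally have "a \<xx> x \<le> a (e X (\<alpha> \<xx>)) (\<alpha> (e X x)) \<otimes> under (X, a) (\<alpha> (e X x)) x"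
      using k_tensor_le(2)[OF repr_adjointD(4)[OF ad True]] order_trans by blast
    also have "\<dots> \<le> a (e X (\<alpha> \<xx>)) x"
      using S al by (intro Tcat_comp_under[OF A]) auto
    finally show ?thesis using al by (simp add: under_pair)
  next
    case False
    then have "a \<xx> x = bot" using Tcat_vrel[OF A] by (simp add: vrel_def)
    then show ?thesis by simp
  qed
  have "under (X, a) (\<alpha> \<xx>) x
      \<le> under (Tcat_T (X, a)) \<xx> (e X (\<alpha> \<xx>)) \<otimes> under (X, a) (\<alpha> \<xx>) x"
    using x by (intro k_tensor_le repr_adjointD[OF ad])
  also have "\<dots> \<le> a \<xx> x"
    using under_Tcat_T_comp[OF A x, of "e X (\<alpha> \<xx>)" x] al by (simp add: under_pair)
  finally show "under (X, a) (\<alpha> \<xx>) x \<le> a \<xx> x" .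
qed

text \<open>
  Representability gives \<open>a \<cdot> m \<le> a \<cdot> T\<^sub>\<xi> a\<close>: the required intermediate element is \<open>T \<alpha>(\<XX>)\<close>. It is related to \<open>\<XX>\<close> because
  \<open>k \<le> a(\<xx>, \<alpha>(\<xx>))\<close>, and functoriality of \<open>\<alpha>\<close> at \<open>(\<XX>, m(\<XX>))\<close> yields \<open>k \<le> a(T \<alpha>(\<XX>), \<alpha>(m(\<XX>)))\<close>.
\<close>

lemma repr_m_le:
  assumes A: "Tcategory (X, a)" and ad: "repr_adjoint (X, a) \<alpha>" and X: "\<XX> \<in> T (T X)"
  shows "a (m X \<XX>) x \<le> vcomp a (Txi (T X) X a) \<XX> x"
proof -
  note S = Tcat_small[OF A]
  have al: "\<alpha> \<in> T X \<rightarrow> X" using repr_adjointD(1)[OF ad] by auto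
  let ?y = "Mr (T X) X \<alpha> \<XX>"
  have y: "?y \<in> T X" and mX: "m X \<XX> \<in> T X" using S al X by auto
  have "a (m X \<XX>) x = under (X, a) (\<alpha> (m X \<XX>)) x"
    using mX by (rule repr_adjoint_eq[OF A ad])
  also have "\<dots> \<le> a ?y (\<alpha> (m X \<XX>)) \<otimes> under (X, a) (\<alpha> (m X \<XX>)) x"
    using Tcat_T_m[OF A X] repr_adjointD(2)[OF ad X mX] by (intro k_tensor_le) (rule order_trans)
  also have "\<dots> \<le> a ?y x" using y by (rule Tcat_comp_under[OF A])
  also have "\<dots> \<le> Txi (T X) X a \<XX> ?y \<otimes> a ?y x"
  proof (intro k_tensor_le k_le_Txi_graph)
    fix \<xx> assume "\<xx> \<in> T X"
    then show "k \<le> a \<xx> (\<alpha> \<xx>)"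
      using repr_adjoint_eq[OF A ad] under_refl[OF A] al by auto
  qed (use S X al in auto)
  also have "\<dots> \<le> vcomp a (Txi (T X) X a) \<XX> x" by (rule vcomp_upper)
  finally show ?thesis .
qed

section \<open>Functors into the quantale\<close>

text \<open>
  Functors into \<open>\<V>\<close> as functions with values in the quantale itself; working with these
  avoids the codes of values, and \<open>enc\<close> leads back to elements of the universe.
\<close>

definition Vfunctor :: "'u set \<times> ('u \<Rightarrow> 'u \<Rightarrow> 'v) \<Rightarrow> ('u \<Rightarrow> 'v) \<Rightarrow> bool" where
  "Vfunctor = (\<lambda>(X, a) \<phi>. \<forall>\<xx>\<in>T X. \<forall>x\<in>X. xiT X \<phi> \<xx> \<otimes> a \<xx> x \<le> \<phi> x)"

definition enc :: "'u set \<Rightarrow> ('u \<Rightarrow> 'v) \<Rightarrow> 'u" where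
  "enc X \<phi> = fgraph X (\<lambda>x\<in>X. cd (\<phi> x))"

lemma enc_cong: "(\<And>x. x \<in> X \<Longrightarrow> \<phi> x = \<psi> x) \<Longrightarrow> enc X \<phi> = enc X \<psi>"
  unfolding enc_def by (metis (mono_tags, lifting) restrict_ext)

lemma fapply_enc: "small X \<Longrightarrow> fapply X (enc X \<phi>) = (\<lambda>x\<in>X. cd (\<phi> x))"
  by (simp add: enc_def fapply_fgraph)

lemma Tfunctor_V_cat:
  assumes "small X"
  shows "Tfunctor (X, a) V_cat (\<lambda>x\<in>X. cd (\<phi> x)) \<longleftrightarrow> Vfunctor (X, a) \<phi>"
proof -
  have "Mr X VS (\<lambda>x. cd (\<phi> x)) \<xx> \<in> T VS" if "\<xx> \<in> T X" for \<xx>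
    using assms that by auto
  then show ?thesis
    by (auto simp: Tfunctor_iff V_cat_def Vfunctor_def xiT_def le_hom_iff commute)
qed

lemma enc_in_funs: "small X \<Longrightarrow> Vfunctor (X, a) \<phi> \<Longrightarrow> enc X \<phi> \<in> funs (X, a)"
  unfolding funs_def enc_def using Tfunctor_V_cat[of X a \<phi>] by auto

lemma funsE:
  assumes "small X" "p \<in> funs (X, a)"
  obtains \<phi> where "p = enc X \<phi>" "Vfunctor (X, a) \<phi>"
proof -
  obtain f where f: "p = fgraph X f" "Tfunctor (X, a) V_cat f"
    using assms by (auto simp: funs_def)
  then have "f \<in> X \<rightarrow>\<^sub>E VS" by (simp add: Tfunctor_iff V_cat_def)
  then have "f = (\<lambda>x\<in>X. cd (dec (f x)))" by (auto simp: fun_eq_iff PiE_iff extensional_def)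
  then show ?thesis
    using f Tfunctor_V_cat[OF assms(1), of a "\<lambda>x. dec (f x)"] that[of "\<lambda>x. dec (f x)"]
    by (simp add: enc_def)
qed

lemma ev_enc:
  assumes "small X" "Vfunctor (X, a) \<phi>"
  shows "ev (X, a) (enc X \<phi>) x = (if x \<in> X then \<phi> x else bot)"
  using enc_in_funs[OF assms] assms by (simp add: ev_def fapply_enc)

lemma Vfunctor_cong: "(\<And>x. x \<in> X \<Longrightarrow> \<phi> x = \<psi> x) \<Longrightarrow> Vfunctor (X, a) \<phi> = Vfunctor (X, a) \<psi>"
  using xiT_cong[of X \<phi> \<psi>] by (simp add: Vfunctor_def)

lemma Vfunctor_ev:
  assumes S: "small X" and p: "p \<in> funs (X, a)"
  shows "Vfunctor (X, a) (ev (X, a) p)"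
proof -
  obtain \<phi> where \<phi>: "p = enc X \<phi>" "Vfunctor (X, a) \<phi>" using funsE[OF S p] .
  then show ?thesis using Vfunctor_cong[of X \<phi> "ev (X, a) p" a] by (simp add: ev_enc[OF S])
qed

lemma enc_ev:
  assumes S: "small X" and p: "p \<in> funs (X, a)"
  shows "enc X (ev (X, a) p) = p"
proof -
  obtain \<phi> where \<phi>: "p = enc X \<phi>" "Vfunctor (X, a) \<phi>" using funsE[OF S p] .
  then show ?thesis using enc_cong[of X \<phi> "ev (X, a) p"] by (simp add: ev_enc[OF S])
qed

lemma funs_eqI:
  assumes "small X" "p \<in> funs (X, a)" "q \<in> funs (X, a)"
    and "\<And>x. x \<in> X \<Longrightarrow> ev (X, a) p x = ev (X, a) q x"
  shows "p = q"
proof -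
  have "enc X (ev (X, a) p) = enc X (ev (X, a) q)" using assms(4) by (rule enc_cong)
  then show ?thesis using assms by (simp add: enc_ev)
qed

lemma small_funs [simp]: "small X \<Longrightarrow> small (funs (X, a))"
proof (rule small_subset)
  show "funs (X, a) \<subseteq> {fgraph X f |f. f \<in> X \<rightarrow>\<^sub>E VS}"
    by (auto simp: funs_def Tfunctor_iff V_cat_def)
qed (simp add: small_fgraphs)

lemma ev_vrel: "ev (X, a) \<in> vrel (funs (X, a)) X"
  by (simp add: ev_def vrel_def)

lemma Vfunctor_le: "Vfunctor (X, a) \<phi> \<Longrightarrow> \<xx> \<in> T X \<Longrightarrow> x \<in> X \<Longrightarrow> xiT X \<phi> \<xx> \<otimes> a \<xx> x \<le> \<phi> x"
  by (simp add: Vfunctor_def)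

lemma \<mu>_pair: "\<mu> (X, a) = vcomp a (Txi (funs (X, a)) X (ev (X, a)))"
  by (simp add: \<mu>_def)

text \<open>
  If \<open>r(p, -)\<close> is a functor, then \<open>a\<close> does not enlarge it, and \<open>e\<close> recovers it by reflexivity. This computes both
  \<open>\<mu> \<cdot> e\<close> and \<open>b \<cdot> T\<^sub>\<xi> \<psi> \<cdot> e\<close>.
\<close>

lemma vcomp_Txi_e:
  assumes A: "Tcategory (X, a)" and P: "small P" "p \<in> P" and r: "Vfunctor (X, a) (r p)" and x: "x \<in> X"
  shows "vcomp a (Txi P X r) (e P p) x = r p x"
proof (rule antisym)
  note S = Tcat_small[OF A]
  show "vcomp a (Txi P X r) (e P p) x \<le> r p x"
  proof (rule vcomp_leastI[OF Txi_vrel])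
    fix \<xx> assume "\<xx> \<in> T X"
    have "Txi P X r (e P p) \<xx> \<otimes> a \<xx> x \<le> xiT X (r p) \<xx> \<otimes> a \<xx> x"
      using S P by (intro tensor_mono Txi_point_le) auto
    also have "\<dots> \<le> r p x" using r \<open>\<xx> \<in> T X\<close> x by (rule Vfunctor_le)
    finally show "Txi P X r (e P p) \<xx> \<otimes> a \<xx> x \<le> r p x" .
  qed (use S P in auto)
  have "r p x \<le> Txi P X r (e P p) (e X x)" using S P x by (intro Txi_e) auto
  also have "\<dots> \<le> Txi P X r (e P p) (e X x) \<otimes> a (e X x) x"
    using Tcat_refl[OF A x] by (rule k_tensor_le)
  also have "\<dots> \<le> vcomp a (Txi P X r) (e P p) x" by (rule vcomp_upper)
  finally show "r p x \<le> vcomp a (Txi P X r) (e P p) x" .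
qed

lemma \<mu>_e:
  assumes A: "Tcategory (X, a)" and "p \<in> funs (X, a)" "x \<in> X"
  shows "\<mu> (X, a) (e (funs (X, a)) p) x = ev (X, a) p x"
  unfolding \<mu>_pair using assms Tcat_small[OF A] Vfunctor_ev by (intro vcomp_Txi_e) auto

lemma \<mu>_Mr:
  assumes A: "Tcategory (X, a)" and "small Z" "f \<in> Z \<rightarrow> funs (X, a)" "\<zz> \<in> T Z"
  shows "\<mu> (X, a) (Mr Z (funs (X, a)) f \<zz>) x = vcomp a (Txi Z X (\<lambda>z. ev (X, a) (f z))) \<zz> x"
  using assms Tcat_small[OF A] by (simp add: \<mu>_pair vcomp_def Txi_Mr)

lemma Txi_\<mu>:
  assumes A: "Tcategory (X, a)"
  shows "Txi (T (funs (X, a))) X (\<mu> (X, a))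
    = vcomp (Txi (T X) X a) (Txi (T (funs (X, a))) (T X) (Txi (funs (X, a)) X (ev (X, a))))"
  unfolding \<mu>_pair using Tcat_small[OF A] by (intro Txi_vcomp Txi_vrel) auto

text \<open>
  Functoriality of \<open>T\<^sub>\<xi>\<close> gives \<open>a \<cdot> T\<^sub>\<xi> \<mu> = a \<cdot> T\<^sub>\<xi> a \<cdot> T\<^sub>\<xi> T\<^sub>\<xi> ev\<close>; now use transitivity of \<open>a\<close> and naturality
  of \<open>m\<close>.
\<close>

lemma \<mu>_m_ge:
  assumes A: "Tcategory (X, a)" and P: "\<PP> \<in> T (T (funs (X, a)))"
  shows "vcomp a (Txi (T (funs (X, a))) X (\<mu> (X, a))) \<PP> x \<le> \<mu> (X, a) (m (funs (X, a)) \<PP>) x"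
proof -
  note S = Tcat_small[OF A]
  let ?F = "funs (X, a)"
  let ?E = "Txi ?F X (ev (X, a))"
  have "vcomp (vcomp a (Txi (T X) X a)) (Txi (T ?F) (T X) ?E) \<PP> x \<le> \<mu> (X, a) (m ?F \<PP>) x"
  proof (rule vcomp_leastI[OF Txi_vrel])
    fix \<XX> assume X: "\<XX> \<in> T (T X)"
    have "Txi (T ?F) (T X) ?E \<PP> \<XX> \<otimes> vcomp a (Txi (T X) X a) \<XX> x
        \<le> ?E (m ?F \<PP>) (m X \<XX>) \<otimes> a (m X \<XX>) x"
      using S P X by (intro tensor_mono Txi_m vcomp_least Tcat_trans[OF A]) auto
    also have "\<dots> \<le> \<mu> (X, a) (m ?F \<PP>) x"
      unfolding \<mu>_pair by (rule vcomp_upper)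
    finally show "Txi (T ?F) (T X) ?E \<PP> \<XX> \<otimes> vcomp a (Txi (T X) X a) \<XX> x \<le> \<mu> (X, a) (m ?F \<PP>) x" .
  qed (use S in auto)
  then show ?thesis by (simp add: Txi_\<mu>[OF A] vcomp_assoc)
qed

text \<open>
  For representable \<open>X\<close> both steps of \<open>\<mu>_m_ge\<close> can be reversed, by \<open>repr_m_le\<close> and \<open>Txi_m_le\<close>.
\<close>

lemma \<mu>_m:
  assumes A: "Tcategory (X, a)" and ad: "repr_adjoint (X, a) \<alpha>" and P: "\<PP> \<in> T (T (funs (X, a)))"
  shows "\<mu> (X, a) (m (funs (X, a)) \<PP>) x = vcomp a (Txi (T (funs (X, a))) X (\<mu> (X, a))) \<PP> x"
proof (rule antisym[OF _ \<mu>_m_ge[OF A P]])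
  note S = Tcat_small[OF A]
  let ?F = "funs (X, a)"
  let ?E = "Txi ?F X (ev (X, a))"
  have "?E (m ?F \<PP>) \<xx> \<otimes> a \<xx> x \<le> vcomp a (Txi (T ?F) X (\<mu> (X, a))) \<PP> x" for \<xx>
  proof -
    have "?E (m ?F \<PP>) \<xx> \<otimes> a \<xx> x
        \<le> (SUP \<XX>\<in>{\<XX> \<in> T (T X). m X \<XX> = \<xx>}. Txi (T ?F) (T X) ?E \<PP> \<XX>) \<otimes> a \<xx> x"
      using S P by (intro tensor_mono Txi_m_le) auto
    also have "\<dots> \<le> vcomp (vcomp a (Txi (T X) X a)) (Txi (T ?F) (T X) ?E) \<PP> x"
      unfolding SUP_tensor
    proof (rule SUP_least)
      fix \<XX> assume X: "\<XX> \<in> {\<XX> \<in> T (T X). m X \<XX> = \<xx>}"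
      have "Txi (T ?F) (T X) ?E \<PP> \<XX> \<otimes> a \<xx> x
          \<le> Txi (T ?F) (T X) ?E \<PP> \<XX> \<otimes> vcomp a (Txi (T X) X a) \<XX> x"
        using X repr_m_le[OF A ad] by (intro tensor_mono) auto
      also have "\<dots> \<le> vcomp (vcomp a (Txi (T X) X a)) (Txi (T ?F) (T X) ?E) \<PP> x"
        by (rule vcomp_upper)
      finally show "Txi (T ?F) (T X) ?E \<PP> \<XX> \<otimes> a \<xx> x
        \<le> vcomp (vcomp a (Txi (T X) X a)) (Txi (T ?F) (T X) ?E) \<PP> x" .
    qed
    finally show ?thesis by (simp add: Txi_\<mu>[OF A] vcomp_assoc)
  qed
  then show "\<mu> (X, a) (m ?F \<PP>) x \<le> vcomp a (Txi (T ?F) X (\<mu> (X, a))) \<PP> x"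
    by (subst \<mu>_pair) (rule vcomp_least)
qed

section \<open>The categories of functors into the quantale\<close>

lemma fst_V_obj [simp]: "fst (V_obj (X, a)) = funs (X, a)"
  by (simp add: V_obj_def)

definition Vstr where "Vstr A = snd (V_obj A)"

lemma V_obj_eq: "V_obj (X, a) = (funs (X, a), Vstr (X, a))"
  by (simp add: V_obj_def Vstr_def)

lemma Vstr_eq: "\<pp> \<in> T (funs (X, a)) \<Longrightarrow> p \<in> funs (X, a) \<Longrightarrow>
    Vstr (X, a) \<pp> p = (INF x\<in>X. hom (ev (X, a) p x) (\<mu> (X, a) \<pp> x))"
  by (simp add: V_obj_def Vstr_def)

lemma Vstr_vrel: "Vstr (X, a) \<in> vrel (T (funs (X, a))) (funs (X, a))"
  by (simp add: V_obj_def Vstr_def vrel_def)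

lemma le_Vstr_iff: "\<pp> \<in> T (funs (X, a)) \<Longrightarrow> p \<in> funs (X, a) \<Longrightarrow>
    v \<le> Vstr (X, a) \<pp> p \<longleftrightarrow> (\<forall>x\<in>X. v \<otimes> ev (X, a) p x \<le> \<mu> (X, a) \<pp> x)"
  by (simp add: Vstr_eq le_INF_iff le_hom_iff)

lemma ev_Vstr_le: "vcomp (ev (X, a)) (Vstr (X, a)) \<le> \<mu> (X, a)"
proof (intro le_funI vcomp_least)
  fix \<pp> x p
  show "Vstr (X, a) \<pp> p \<otimes> ev (X, a) p x \<le> \<mu> (X, a) \<pp> x"
  proof (cases "\<pp> \<in> T (funs (X, a)) \<and> p \<in> funs (X, a) \<and> x \<in> X")
    case True
    then show ?thesis using le_Vstr_iff[of \<pp> X a p "Vstr (X, a) \<pp> p"] by simp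
  next
    case False
    then have "Vstr (X, a) \<pp> p = bot \<or> ev (X, a) p x = bot"
      using Vstr_vrel[of X a] ev_vrel[of X a] by (auto simp: vrel_def)
    then show ?thesis by auto
  qed
qed

text \<open>
  With \<open>c\<close> the structure of \<open>V X\<close>, this is \<open>\<mu> \<cdot> T\<^sub>\<xi> c = a \<cdot> T\<^sub>\<xi>(ev \<cdot> c) \<le> a \<cdot> T\<^sub>\<xi> \<mu>\<close>. It yields transitivity of \<open>c\<close> as
  well as functoriality of the left adjoint of \<open>e\<close>.
\<close>

lemma Txi_Vstr_\<mu>:
  assumes A: "Tcategory (X, a)"
  shows "Txi (T (funs (X, a))) (funs (X, a)) (Vstr (X, a)) \<PP> \<pp> \<otimes> \<mu> (X, a) \<pp> x
    \<le> vcomp a (Txi (T (funs (X, a))) X (\<mu> (X, a))) \<PP> x"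
proof -
  note S = Tcat_small[OF A]
  let ?F = "funs (X, a)"
  have "Txi (T ?F) ?F (Vstr (X, a)) \<PP> \<pp> \<otimes> \<mu> (X, a) \<pp> x
      \<le> vcomp (\<mu> (X, a)) (Txi (T ?F) ?F (Vstr (X, a))) \<PP> x" by (rule vcomp_upper)
  also have "\<dots> = vcomp a (Txi (T ?F) X (vcomp (ev (X, a)) (Vstr (X, a)))) \<PP> x"
    using S by (simp add: \<mu>_pair vcomp_assoc Txi_vcomp[OF _ _ _ Vstr_vrel])
  also have "\<dots> \<le> vcomp a (Txi (T ?F) X (\<mu> (X, a))) \<PP> x"
    using S ev_Vstr_le[of X a]
    by (intro vcomp_mono[THEN le_funD, THEN le_funD] Txi_mono) (auto simp: le_fun_def)
  finally show ?thesis .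
qed

lemma Tcategory_V_obj:
  assumes A: "Tcategory (X, a)"
  shows "Tcategory (V_obj (X, a))"
  unfolding V_obj_eq
proof (rule TcategoryI)
  note S = Tcat_small[OF A]
  let ?F = "funs (X, a)"
  show "small ?F" using S by simp
  show "Vstr (X, a) \<in> vrel (T ?F) ?F" by (rule Vstr_vrel)
  show "k \<le> Vstr (X, a) (e ?F p) p" if "p \<in> ?F" for p
    using S that by (simp add: le_Vstr_iff \<mu>_e[OF A])
  show "Txi (T ?F) ?F (Vstr (X, a)) \<PP> \<pp> \<otimes> Vstr (X, a) \<pp> p \<le> Vstr (X, a) (m ?F \<PP>) p"
    if P: "\<PP> \<in> T (T ?F)" "\<pp> \<in> T ?F" "p \<in> ?F" for \<PP> \<pp> p
  proof -
    have "Txi (T ?F) ?F (Vstr (X, a)) \<PP> \<pp> \<otimes> Vstr (X, a) \<pp> p \<otimes> ev (X, a) p x \<le> \<mu> (X, a) (m ?F \<PP>) x"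
      if "x \<in> X" for x
    proof -
      have "Vstr (X, a) \<pp> p \<otimes> ev (X, a) p x \<le> \<mu> (X, a) \<pp> x"
        using le_Vstr_iff P that by blast
      then have "Txi (T ?F) ?F (Vstr (X, a)) \<PP> \<pp> \<otimes> Vstr (X, a) \<pp> p \<otimes> ev (X, a) p x
          \<le> Txi (T ?F) ?F (Vstr (X, a)) \<PP> \<pp> \<otimes> \<mu> (X, a) \<pp> x"
        by (simp add: assoc tensor_mono)
      also have "\<dots> \<le> vcomp a (Txi (T ?F) X (\<mu> (X, a))) \<PP> x" by (rule Txi_Vstr_\<mu>[OF A])
      also have "\<dots> \<le> \<mu> (X, a) (m ?F \<PP>) x" using P by (intro \<mu>_m_ge[OF A])
      finally show ?thesis .
    qed
    then show ?thesis using S P by (subst le_Vstr_iff) auto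
  qed
qed

text \<open>
  By \<open>Txi_point\<close> the claim is \<open>a \<cdot> T\<^sub>\<xi> \<mu> \<cdot> e \<le> \<mu>\<close>, which follows from \<open>\<mu>_m_ge\<close> and \<open>m \<cdot> e = 1\<close>.
\<close>

lemma Vfunctor_\<mu>:
  assumes T1: "is_singleton (T one)" and A: "Tcategory (X, a)" and p: "\<pp> \<in> T (funs (X, a))"
  shows "Vfunctor (X, a) (\<mu> (X, a) \<pp>)"
  unfolding Vfunctor_def prod.case
proof (intro ballI)
  note S = Tcat_small[OF A]
  let ?F = "funs (X, a)"
  fix \<xx> x assume x: "\<xx> \<in> T X" "x \<in> X"
  have "xiT X (\<mu> (X, a) \<pp>) \<xx> \<otimes> a \<xx> x = Txi (T ?F) X (\<mu> (X, a)) (e (T ?F) \<pp>) \<xx> \<otimes> a \<xx> x"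
    using S p x by (simp add: Txi_point[OF T1])
  also have "\<dots> \<le> vcomp a (Txi (T ?F) X (\<mu> (X, a))) (e (T ?F) \<pp>) x" by (rule vcomp_upper)
  also have "\<dots> \<le> \<mu> (X, a) (m ?F (e (T ?F) \<pp>)) x"
    using S p by (intro \<mu>_m_ge[OF A]) auto
  finally show "xiT X (\<mu> (X, a) \<pp>) \<xx> \<otimes> a \<xx> x \<le> \<mu> (X, a) \<pp> x"
    using S p by (simp add: m_e_T)
qed

text \<open>
  As \<open>\<mu> \<cdot> e = ev\<close>, the underlying order of \<open>V X\<close> is the reverse of the pointwise order. In particular, it
  is antisymmetric.
\<close>

lemma under_V_obj:
  assumes A: "Tcategory (X, a)" and "p \<in> funs (X, a)" "q \<in> funs (X, a)"
  shows "under (V_obj (X, a)) p q = (INF x\<in>X. hom (ev (X, a) q x) (ev (X, a) p x))"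
  using assms Tcat_small[OF A] by (simp add: V_obj_eq under_pair Vstr_eq \<mu>_e cong: INF_cong)

lemma k_le_under_V_obj:
  assumes A: "Tcategory (X, a)" and "p \<in> funs (X, a)" "q \<in> funs (X, a)"
  shows "k \<le> under (V_obj (X, a)) p q \<longleftrightarrow> (\<forall>x\<in>X. ev (X, a) q x \<le> ev (X, a) p x)"
  using assms by (simp add: under_V_obj le_INF_iff le_hom_iff)

text \<open>
  The left adjoint of \<open>e\<close> is \<open>\<mu>\<close>. The structure of \<open>V X\<close> is \<open>c(\<pp>, \<phi>) = [\<phi>, \<mu>(\<pp>)]\<close>, and \<open>[\<phi>, \<psi>]\<close> is the underlying
  category evaluated at \<open>(\<psi>, \<phi>)\<close>, so \<open>\<mu>\<close> represents \<open>c\<close>. That \<open>\<mu>\<close> is a functor from \<open>T V X\<close> is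
  where representability of \<open>X\<close> enters, through \<open>\<mu> \<cdot> m = a \<cdot> T\<^sub>\<xi> \<mu> = \<mu> \<cdot> T \<beta>\<close>.
\<close>

lemma repr_adjoint_V_obj:
  assumes T1: "is_singleton (T one)" and A: "Tcategory (X, a)" and ad: "repr_adjoint (X, a) \<alpha>"
  shows "repr_adjoint (V_obj (X, a)) (\<lambda>\<pp>\<in>T (funs (X, a)). enc X (\<mu> (X, a) \<pp>))"
proof -
  note S = Tcat_small[OF A]
  let ?F = "funs (X, a)" and ?c = "Vstr (X, a)"
  let ?\<beta>' = "\<lambda>\<pp>. enc X (\<mu> (X, a) \<pp>)" 
  let ?\<beta> = "restrict ?\<beta>' (T ?F)"
  have SF: "small ?F" using S by simp
  \<comment> \<open>The raw function \<open>?\<beta>'\<close> and its restriction \<open>?\<beta>\<close> are kept apart, as \<open>Mr\<close> restricts by itself.\<close>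
  have VA: "Tcategory (?F, ?c)" using Tcategory_V_obj[OF A] by (simp add: V_obj_eq)
  have b: "?\<beta>' \<pp> \<in> ?F" if "\<pp> \<in> T ?F" for \<pp>
    using S Vfunctor_\<mu>[OF T1 A that] by (rule enc_in_funs)
  have evb: "ev (X, a) (?\<beta>' \<pp>) x = \<mu> (X, a) \<pp> x" if "\<pp> \<in> T ?F" "x \<in> X" for \<pp> x
    using S Vfunctor_\<mu>[OF T1 A that(1)] that(2) by (simp add: ev_enc)
  have bF: "?\<beta>' \<in> T ?F \<rightarrow> ?F" using b by auto
  have \<mu>Tb: "\<mu> (X, a) (Mr (T ?F) ?F ?\<beta>' \<PP>) x = \<mu> (X, a) (m ?F \<PP>) x" if P: "\<PP> \<in> T (T ?F)" for \<PP> x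
  proof -
    have "Txi (T ?F) X (\<lambda>\<pp>. ev (X, a) (?\<beta>' \<pp>)) = Txi (T ?F) X (\<mu> (X, a))"
      by (rule Txi_cong) (rule evb)
    then show ?thesis using S P bF \<mu>_Mr[OF A, of "T ?F" ?\<beta>' \<PP>] by (simp add: \<mu>_m[OF A ad P])
  qed
  have "snd (Tcat_T (?F, ?c)) \<PP> \<pp> \<le> ?c (Mr (T ?F) ?F ?\<beta>' \<PP>) (?\<beta>' \<pp>)"
    if P: "\<PP> \<in> T (T ?F)" "\<pp> \<in> T ?F" for \<PP> \<pp>
    unfolding snd_Tcat_T[OF P(1)]
  proof (rule SUP_least)
    fix \<QQ> assume Q: "\<QQ> \<in> {\<YY> \<in> T (T ?F). m ?F \<YY> = m ?F \<PP>}"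
    have "Txi (T ?F) ?F ?c \<QQ> \<pp> \<otimes> \<mu> (X, a) \<pp> x \<le> \<mu> (X, a) (m ?F \<PP>) x" for x
      using Txi_Vstr_\<mu>[OF A, of \<QQ> \<pp> x] \<mu>_m[OF A ad, of \<QQ> x] Q by auto
    moreover have "Mr (T ?F) ?F ?\<beta>' \<PP> \<in> T ?F" using SF bF P by auto
    ultimately show "Txi (T ?F) ?F ?c \<QQ> \<pp> \<le> ?c (Mr (T ?F) ?F ?\<beta>' \<PP>) (?\<beta>' \<pp>)"
      using P b by (subst le_Vstr_iff) (auto simp: evb \<mu>Tb)
  qed
  then have "Tfunctor (Tcat_T (?F, ?c)) (?F, ?c) ?\<beta>"
    using b by (auto simp: Tfunctor_iff)
  moreover have "k \<le> under (Tcat_T (?F, ?c)) \<pp> (e ?F (?\<beta>' \<pp>))" if p: "\<pp> \<in> T ?F" for \<pp>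
  proof -
    have "k \<le> ?c \<pp> (?\<beta>' \<pp>)" using p b by (subst le_Vstr_iff) (auto simp: evb)
    also have "\<dots> \<le> under (Tcat_T (?F, ?c)) \<pp> (e ?F (?\<beta>' \<pp>))"
      using p b by (intro le_under_Tcat_T[OF VA]) auto
    finally show ?thesis .
  qed
  moreover have "k \<le> under (?F, ?c) (?\<beta>' (e ?F p)) p" if p: "p \<in> ?F" for p
  proof -
    have ep: "e ?F p \<in> T ?F" using SF p by simp
    show ?thesis
      using k_le_under_V_obj[OF A b[OF ep] p] p ep by (simp add: V_obj_eq evb \<mu>_e[OF A])
  qed
  ultimately show ?thesis
    using e_Tfunctor[OF VA] SF
    by (simp add: repr_adjoint_def adjoint_def V_obj_eq map_le_def compose_def)
qed

text \<open>
  Left adjoints are determined up to equivalence, and equivalent elements of \<open>V X\<close> are equal.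
\<close>

lemma repr_adjoint_V_obj_unique:
  assumes T1: "is_singleton (T one)" and A: "Tcategory (X, a)" and b: "repr_adjoint (V_obj (X, a)) \<beta>"
    and p: "\<pp> \<in> T (funs (X, a))"
  shows "\<beta> \<pp> = enc X (\<mu> (X, a) \<pp>)"
proof (rule funs_eqI[of X _ a])
  note S = Tcat_small[OF A]
  let ?F = "funs (X, a)" and ?c = "Vstr (X, a)"
  note b' = b[unfolded V_obj_eq]
  have VA: "Tcategory (?F, ?c)" using Tcategory_V_obj[OF A] by (simp add: V_obj_eq)
  show "small X" by (rule S)
  show bF: "\<beta> \<pp> \<in> ?F" using repr_adjointD(1)[OF b'] p by auto
  show eF: "enc X (\<mu> (X, a) \<pp>) \<in> ?F" using S Vfunctor_\<mu>[OF T1 A p] by (rule enc_in_funs)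
  have eq: "?c \<pp> q = under (V_obj (X, a)) (\<beta> \<pp>) q" for q
    using repr_adjoint_eq[OF VA b' p] by (simp add: V_obj_eq)
  have evm: "ev (X, a) (enc X (\<mu> (X, a) \<pp>)) x = \<mu> (X, a) \<pp> x" if "x \<in> X" for x
    using S Vfunctor_\<mu>[OF T1 A p] that by (simp add: ev_enc)
  fix x assume x: "x \<in> X"
  show "ev (X, a) (\<beta> \<pp>) x = ev (X, a) (enc X (\<mu> (X, a) \<pp>)) x"
  proof (rule antisym)
    have "k \<le> ?c \<pp> (\<beta> \<pp>)" unfolding eq using k_le_under_V_obj[OF A bF bF] by simp
    then show "ev (X, a) (\<beta> \<pp>) x \<le> ev (X, a) (enc X (\<mu> (X, a) \<pp>)) x"
      using le_Vstr_iff[OF p bF, of k] x by (simp add: evm)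
    have "k \<le> ?c \<pp> (enc X (\<mu> (X, a) \<pp>))"
      using le_Vstr_iff[OF p eF, of k] by (simp add: evm)
    then show "ev (X, a) (enc X (\<mu> (X, a) \<pp>)) x \<le> ev (X, a) (\<beta> \<pp>) x"
      unfolding eq using k_le_under_V_obj[OF A bF eF] x by simp
  qed
qed

section \<open>The category of distributors\<close>

lemma representableE:
  assumes "representable A"
  obtains X a \<alpha> where "A = (X, a)" "Tcategory (X, a)" "repr_adjoint (X, a) \<alpha>"
  using assms by (cases A) (auto simp: representable_def)

text \<open>
  The relation \<open>T\<^sub>\<xi>(a\<^sub>0)\<close> is \<open>T\<^sub>\<xi> a \<cdot> T e\<close>, so that transitivity of \<open>a\<close> and \<open>m \<cdot> T e = 1\<close> give one inequality;
  \<open>T\<^sub>\<xi>(a\<^sub>0)\<close> is reflexive, which gives the other one.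
\<close>

lemma vcomp_Txi_under:
  assumes A: "Tcategory (X, a)"
  shows "vcomp a (Txi X X (under (X, a))) = a"
proof (rule antisym; intro le_funI)
  fix \<xx> x
  note S = Tcat_small[OF A]
  show "vcomp a (Txi X X (under (X, a))) \<xx> x \<le> a \<xx> x"
  proof (cases "\<xx> \<in> T X")
    case True
    have "Txi X X (under (X, a)) = Txi X X (\<lambda>x. a (e X x))"
      by (rule Txi_cong) (simp add: under_pair)
    moreover have "Txi X X (\<lambda>x. a (e X x)) \<xx> \<yy> = Txi (T X) X a (Mr X (T X) (e X) \<xx>) \<yy>" for \<yy>
      using S True by (subst Txi_Mr) auto
    moreover have "Mr X (T X) (e X) \<xx> \<in> T (T X)" "m X (Mr X (T X) (e X) \<xx>) = \<xx>"
      using S True by (auto simp: m_T_e)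
    ultimately show ?thesis
      using Tcat_trans[OF A, of "Mr X (T X) (e X) \<xx>"] by (auto intro!: vcomp_least)
  next
    case False
    then have "Txi X X (under (X, a)) \<xx> \<yy> = bot" for \<yy>
      using Txi_vrel[OF S S] by (auto simp: vrel_def)
    then show ?thesis by (intro vcomp_least) simp
  qed
  show "a \<xx> x \<le> vcomp a (Txi X X (under (X, a))) \<xx> x"
  proof (cases "\<xx> \<in> T X")
    case True
    then have "k \<le> Txi X X (under (X, a)) \<xx> (Mr X X (\<lambda>x. x) \<xx>)"
      using S under_refl[OF A] by (intro k_le_Txi_graph) auto
    then have "a \<xx> x \<le> Txi X X (under (X, a)) \<xx> \<xx> \<otimes> a \<xx> x"
      using S True by (intro k_tensor_le) (simp add: Mr_id)
    also have "\<dots> \<le> vcomp a (Txi X X (under (X, a))) \<xx> x" by (rule vcomp_upper)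
    finally show ?thesis .
  next
    case False
    then have "a \<xx> x = bot" using Tcat_vrel[OF A] by (simp add: vrel_def)
    then show ?thesis by simp
  qed
qed

lemma vcomp_under_left:
  assumes A: "Tcategory (X, a)" and r: "r \<in> vrel Y X" and "vcomp (under (X, a)) r \<le> r"
  shows "vcomp (under (X, a)) r = r"
proof (rule antisym[OF assms(3)], intro le_funI)
  fix y x
  show "r y x \<le> vcomp (under (X, a)) r y x"
  proof (cases "x \<in> X")
    case True
    then have "r y x \<le> r y x \<otimes> under (X, a) x x" by (intro k_tensor_le under_refl[OF A])
    also have "\<dots> \<le> vcomp (under (X, a)) r y x" by (rule vcomp_upper)
    finally show ?thesis .
  qed (use r in \<open>auto simp: vrel_def\<close>)
qed

lemma vcomp_under_right:
  assumes A: "Tcategory (X, a)" and r: "r \<in> vrel X Y" and "vcomp r (under (X, a)) \<le> r"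
  shows "vcomp r (under (X, a)) = r"
proof (rule antisym[OF assms(3)], intro le_funI)
  fix x y
  show "r x y \<le> vcomp r (under (X, a)) x y"
  proof (cases "x \<in> X")
    case True
    then have "r x y \<le> under (X, a) x x \<otimes> r x y" by (intro k_tensor_le under_refl[OF A])
    also have "\<dots> \<le> vcomp r (under (X, a)) x y" by (rule vcomp_upper)
    finally show ?thesis .
  qed (use r in \<open>auto simp: vrel_def\<close>)
qed

lemma vcomp_under:
  assumes A: "Tcategory (X, a)"
  shows "vcomp (under (X, a)) a = a"
proof (rule vcomp_under_left[OF A Tcat_vrel[OF A]], intro le_funI vcomp_leastI[OF Tcat_vrel[OF A]])
  fix \<xx> x y
  show "a \<xx> x \<otimes> under (X, a) x y \<le> a \<xx> y"
    using Tcat_comp_under[OF A, of \<xx> x y] Tcat_vrel[OF A] by (cases "\<xx> \<in> T X") (auto simp: vrel_def)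
qed

lemma under_vrel: "Tcategory (X, a) \<Longrightarrow> under (X, a) \<in> vrel X X"
  using Tcat_vrel[of X a] by (simp add: vrel_def under_pair)

lemma repr_dist_under:
  assumes A: "Tcategory (X, a)"
  shows "repr_dist (X, a) (X, a) (under (X, a))"
proof -
  have "vcomp (under (X, a)) (under (X, a)) = under (X, a)"
    using vcomp_under[OF A] vcomp_assoc[of "under (X, a)" a "vgraph X (e X)"] by (simp add: under_def)
  then show ?thesis
    using under_vrel[OF A] vcomp_under[OF A] vcomp_Txi_under[OF A] by (simp add: repr_dist_def)
qed

lemma repr_dist_comp:
  assumes "Tcategory (X, a)" "Tcategory (Y, b)" "Tcategory (Z, c)"
    and \<phi>: "repr_dist (X, a) (Y, b) \<phi>" and \<psi>: "repr_dist (Y, b) (Z, c) \<psi>"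
  shows "repr_dist (X, a) (Z, c) (vcomp \<psi> \<phi>)"
proof -
  have S: "small X" "small Y" "small Z" using assms by (auto simp: Tcat_small)
  have r: "\<phi> \<in> vrel X Y" "\<psi> \<in> vrel Y Z" and l: "vcomp \<phi> (under (X, a)) \<le> \<phi>" "vcomp (under (Z, c)) \<psi> \<le> \<psi>"
    and eq: "vcomp \<phi> a = vcomp b (Txi X Y \<phi>)" "vcomp \<psi> b = vcomp c (Txi Y Z \<psi>)"
    using \<phi> \<psi> by (auto simp: repr_dist_def)
  have "vcomp (vcomp \<psi> \<phi>) a = vcomp c (Txi X Z (vcomp \<psi> \<phi>))"
  proof -
    have "vcomp (vcomp \<psi> \<phi>) a = vcomp \<psi> (vcomp b (Txi X Y \<phi>))"
      by (simp only: eq flip: vcomp_assoc)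
    also have "\<dots> = vcomp c (vcomp (Txi Y Z \<psi>) (Txi X Y \<phi>))"
      by (simp only: eq vcomp_assoc)
    finally show ?thesis by (simp only: Txi_vcomp[OF S r(1)])
  qed
  moreover have "vcomp (vcomp \<psi> \<phi>) (under (X, a)) \<le> vcomp \<psi> \<phi>"
    using l(1) by (simp add: vcomp_mono flip: vcomp_assoc)
  moreover have "vcomp (under (Z, c)) (vcomp \<psi> \<phi>) \<le> vcomp \<psi> \<phi>"
    using l(2) by (simp add: vcomp_mono vcomp_assoc)
  ultimately show ?thesis using r by (simp add: repr_dist_def vcomp_in_vrel)
qed

lemma category_ReprDist: "category ReprDist"
proof -
  have D: "\<psi> \<in> vrel X Y" "vcomp \<psi> (under (X, a)) \<le> \<psi>" "vcomp (under (Y, b)) \<psi> \<le> \<psi>"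
    if "repr_dist (X, a) (Y, b) \<psi>" for X a Y b \<psi>
    using that by (auto simp: repr_dist_def)
  have 1: "repr_dist A A (under A)" if "representable A" for A
    using that by (elim representableE) (simp add: repr_dist_under)
  have 2: "repr_dist A C (vcomp \<psi> \<phi>)"
    if "representable A" "representable B" "representable C" "repr_dist A B \<phi>" "repr_dist B C \<psi>"
    for A B C \<phi> \<psi>
    using that by (elim representableE) (auto intro: repr_dist_comp)
  have 3: "vcomp \<psi> (under A) = \<psi>" "vcomp (under B) \<psi> = \<psi>"
    if "representable A" "representable B" "repr_dist A B \<psi>" for A B \<psi>
    using that by (auto elim!: representableE intro: vcomp_under_right vcomp_under_left dest: D)
  show ?thesis
    unfolding category_def ReprDist_def
    by (simp add: 1 2 3 vcomp_assoc)
qed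

section \<open>Homomorphisms into functor categories as distributors\<close>

text \<open>
  The mate of a map \<open>f\<close> from \<open>A\<close> into the functors on \<open>B\<close>.
\<close>

definition dist_of ::
  "'u set \<times> ('u \<Rightarrow> 'u \<Rightarrow> 'v) \<Rightarrow> 'u set \<times> ('u \<Rightarrow> 'u \<Rightarrow> 'v) \<Rightarrow> ('u \<Rightarrow> 'u) \<Rightarrow> 'u \<Rightarrow> 'u \<Rightarrow> 'v" where
  "dist_of A B f = (\<lambda>x y. if x \<in> fst A then ev B (f x) y else bot)"

definition map_of_dist ::
  "'u set \<times> ('u \<Rightarrow> 'u \<Rightarrow> 'v) \<Rightarrow> 'u set \<times> ('u \<Rightarrow> 'u \<Rightarrow> 'v) \<Rightarrow> ('u \<Rightarrow> 'u \<Rightarrow> 'v) \<Rightarrow> 'u \<Rightarrow> 'u" where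
  "map_of_dist A B \<psi> = (\<lambda>x\<in>fst A. enc (fst B) (\<psi> x))"

lemma dist_of_vrel: "dist_of (X, a) (Y, b) f \<in> vrel X Y"
  using ev_vrel[of Y b] by (simp add: dist_of_def vrel_def)

lemma map_of_dist_of:
  assumes "small Y" "f \<in> X \<rightarrow>\<^sub>E funs (Y, b)"
  shows "map_of_dist (X, a) (Y, b) (dist_of (X, a) (Y, b) f) = f"
proof
  fix x
  show "map_of_dist (X, a) (Y, b) (dist_of (X, a) (Y, b) f) x = f x"
  proof (cases "x \<in> X")
    case True
    then show ?thesis
      using enc_ev[OF assms(1) PiE_mem[OF assms(2) True]] by (simp add: map_of_dist_def dist_of_def)
  next
    case False
    then show ?thesis using PiE_arb[OF assms(2)] by (simp add: map_of_dist_def)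
  qed
qed

lemma dist_of_map_of_dist:
  assumes "small Y" "\<psi> \<in> vrel X Y" "\<And>x. x \<in> X \<Longrightarrow> Vfunctor (Y, b) (\<psi> x)"
  shows "dist_of (X, a) (Y, b) (map_of_dist (X, a) (Y, b) \<psi>) = \<psi>"
  using assms by (intro ext) (auto simp: map_of_dist_def dist_of_def ev_enc vrel_def)

lemma Tfunctor_V_obj_iff:
  assumes A: "Tcategory (X, a)" and B: "Tcategory (Y, b)" and f: "f \<in> X \<rightarrow>\<^sub>E funs (Y, b)"
  defines "\<psi> \<equiv> dist_of (X, a) (Y, b) f"
  shows "Tfunctor (X, a) (V_obj (Y, b)) f
    \<longleftrightarrow> (\<forall>\<xx>\<in>T X. \<forall>y\<in>Y. vcomp \<psi> a \<xx> y \<le> vcomp b (Txi X Y \<psi>) \<xx> y)"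
proof -
  note SX = Tcat_small[OF A] and SY = Tcat_small[OF B]
  let ?F = "funs (Y, b)"
  have fF: "f \<in> X \<rightarrow> ?F" and fr: "restrict f X = f" using f by (auto simp: PiE_restrict)
  have mu: "\<mu> (Y, b) (M X ?F f \<xx>) y = vcomp b (Txi X Y \<psi>) \<xx> y" if "\<xx> \<in> T X" for \<xx> y
  proof -
    have "Txi X Y (\<lambda>x. ev (Y, b) (f x)) = Txi X Y \<psi>"
      by (rule Txi_cong) (simp add: \<psi>_def dist_of_def)
    then show ?thesis using \<mu>_Mr[OF B SX fF that] by (simp add: fr)
  qed
  have in_T: "M X ?F f \<xx> \<in> T ?F" if "\<xx> \<in> T X" for \<xx>
    using Mr_in[OF SX _ fF that] SY by (simp add: fr)
  have "Tfunctor (X, a) (V_obj (Y, b)) f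
    \<longleftrightarrow> (\<forall>\<xx>\<in>T X. \<forall>x\<in>X. \<forall>y\<in>Y. a \<xx> x \<otimes> \<psi> x y \<le> vcomp b (Txi X Y \<psi>) \<xx> y)"
    using f fF in_T
    by (auto simp: Tfunctor_iff V_obj_eq le_Vstr_iff mu \<psi>_def dist_of_def Pi_iff)
  moreover have "vcomp \<psi> a \<xx> y \<le> v \<longleftrightarrow> (\<forall>x\<in>X. a \<xx> x \<otimes> \<psi> x y \<le> v)" for \<xx> y v
    using vcomp_leastI[OF Tcat_vrel[OF A]] vcomp_upper[of a \<xx> _ \<psi> y] order_trans by blast
  ultimately show ?thesis by blast
qed

text \<open>
  Since \<open>a = a\<^sub>0 \<cdot> \<alpha>\<close>, the composite \<open>\<psi> \<cdot> a\<close> is \<open>(\<psi> \<cdot> a\<^sub>0) \<cdot> \<alpha> = \<psi> \<cdot> \<alpha>\<close>.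
\<close>

lemma vcomp_dist_repr:
  assumes A: "Tcategory (X, a)" and ad: "repr_adjoint (X, a) \<alpha>"
    and r: "\<psi> \<in> vrel X Y" and le: "vcomp \<psi> (under (X, a)) \<le> \<psi>" and x: "\<xx> \<in> T X"
  shows "vcomp \<psi> a \<xx> y = \<psi> (\<alpha> \<xx>) y"
proof -
  have "vcomp \<psi> a \<xx> y = vcomp \<psi> (under (X, a)) (\<alpha> \<xx>) y"
    using repr_adjoint_eq[OF A ad x] by (simp add: vcomp_def)
  then show ?thesis by (simp add: vcomp_under_right[OF A r le])
qed

text \<open>
  As a relation, \<open>\<xi> \<cdot> T(\<psi>(x, -))\<close> is \<open>T\<^sub>\<xi> \<psi> \<cdot> e(x)\<close>, hence \<open>b \<cdot> T\<^sub>\<xi> \<psi> \<cdot> e = \<psi> \<cdot> a \<cdot> e = \<psi> \<cdot> a\<^sub>0 \<le> \<psi>\<close> is the claim.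
\<close>

lemma Vfunctor_dist:
  assumes T1: "is_singleton (T one)" and A: "Tcategory (X, a)" and B: "Tcategory (Y, b)"
    and \<psi>: "repr_dist (X, a) (Y, b) \<psi>" and x: "x \<in> X"
  shows "Vfunctor (Y, b) (\<psi> x)"
  unfolding Vfunctor_def prod.case
proof (intro ballI)
  note SX = Tcat_small[OF A] and SY = Tcat_small[OF B]
  have le: "vcomp \<psi> (under (X, a)) \<le> \<psi>" and eq: "vcomp \<psi> a = vcomp b (Txi X Y \<psi>)"
    using \<psi> by (auto simp: repr_dist_def)
  fix \<yy> y assume y: "\<yy> \<in> T Y" "y \<in> Y"
  have "xiT Y (\<psi> x) \<yy> \<otimes> b \<yy> y = Txi X Y \<psi> (e X x) \<yy> \<otimes> b \<yy> y"
    using SX SY x y by (simp add: Txi_point[OF T1])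
  also have "\<dots> \<le> vcomp b (Txi X Y \<psi>) (e X x) y" by (rule vcomp_upper)
  also have "\<dots> = vcomp \<psi> a (e X x) y" by (simp only: eq)
  also have "\<dots> = vcomp \<psi> (under (X, a)) x y" using x by (simp add: vcomp_def under_pair)
  also have "\<dots> \<le> \<psi> x y" using le by (simp add: le_fun_def)
  finally show "xiT Y (\<psi> x) \<yy> \<otimes> b \<yy> y \<le> \<psi> x y" .
qed

text \<open>
  Functoriality of \<open>f\<close> is \<open>\<psi> \<cdot> a \<le> b \<cdot> T\<^sub>\<xi> \<psi>\<close>, and it implies both distributor inequalities, because
  \<open>b \<cdot> T\<^sub>\<xi> \<psi> \<cdot> e = \<psi>\<close> when all \<open>\<psi>(x, -)\<close> are functors. The two composites in the definition of a
  pseudo-homomorphism are the maps \<open>\<xx> \<mapsto> (b \<cdot> T\<^sub>\<xi> \<psi>)(\<xx>, -)\<close> and \<open>\<xx> \<mapsto> \<psi>(\<alpha>(\<xx>), -) = (\<psi> \<cdot> a)(\<xx>, -)\<close>, and they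
  are equivalent only if they are equal.
\<close>

lemma pseudo_hom_V_obj_iff:
  assumes T1: "is_singleton (T one)"
    and A: "Tcategory (X, a)" "repr_adjoint (X, a) \<alpha>" and B: "Tcategory (Y, b)" "repr_adjoint (Y, b) \<beta>"
    and f: "f \<in> X \<rightarrow>\<^sub>E funs (Y, b)"
  defines "\<psi> \<equiv> dist_of (X, a) (Y, b) f"
  shows "pseudo_hom (X, a) (V_obj (Y, b)) f \<longleftrightarrow> repr_dist (X, a) (Y, b) \<psi>"
proof -
  note SX = Tcat_small[OF A(1)] and SY = Tcat_small[OF B(1)]
  let ?F = "funs (Y, b)"
  have fF: "f x \<in> ?F" if "x \<in> X" for x using f that by auto
  have fr: "restrict f X = f" using f by (rule PiE_restrict)
  have r: "\<psi> \<in> vrel X Y" unfolding \<psi>_def by (rule dist_of_vrel)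
  have Vf: "Vfunctor (Y, b) (\<psi> x)" if "x \<in> X" for x
    using Vfunctor_ev[OF SY fF[OF that]] that by (simp add: \<psi>_def dist_of_def)
  have bT: "vcomp b (Txi X Y \<psi>) (e X x) y = \<psi> x y" if "x \<in> X" "y \<in> Y" for x y
    using SX that by (intro vcomp_Txi_e[OF B(1)] Vf) auto
  have r1: "vcomp b (Txi X Y \<psi>) \<in> vrel (T X) Y" "vcomp \<psi> a \<in> vrel (T X) Y"
    using SX SY r Tcat_vrel[OF B(1)] Tcat_vrel[OF A(1)] by (auto intro!: vcomp_in_vrel Txi_vrel)
  \<comment> \<open>\<open>b\<^sub>0 \<cdot> \<psi> = b \<cdot> e \<cdot> \<psi> \<le> b \<cdot> T\<^sub>\<xi> \<psi> \<cdot> e = \<psi>\<close>, as \<open>e\<close> is oplax.\<close>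
  have left: "vcomp (under (Y, b)) \<psi> \<le> \<psi>"
  proof (intro le_funI vcomp_leastI[OF r])
    fix x y' y assume y': "y' \<in> Y"
    show "\<psi> x y' \<otimes> under (Y, b) y' y \<le> \<psi> x y"
    proof (cases "x \<in> X \<and> y \<in> Y")
      case True
      have "\<psi> x y' \<otimes> under (Y, b) y' y \<le> Txi X Y \<psi> (e X x) (e Y y') \<otimes> b (e Y y') y"
        using SX SY True y' by (intro tensor_mono Txi_e) (auto simp: under_pair)
      also have "\<dots> \<le> vcomp b (Txi X Y \<psi>) (e X x) y" by (rule vcomp_upper)
      finally show ?thesis using True by (simp add: bT)
    next
      case False
      then have "\<psi> x y' = bot \<or> under (Y, b) y' y = bot"
        using r Tcat_vrel[OF B(1)] by (auto simp: vrel_def under_pair)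
      then show ?thesis by auto
    qed
  qed
  have right: "vcomp \<psi> (under (X, a)) \<le> \<psi>" if "vcomp \<psi> a \<le> vcomp b (Txi X Y \<psi>)"
  proof (intro le_funI)
    fix x y
    show "vcomp \<psi> (under (X, a)) x y \<le> \<psi> x y"
    proof (cases "x \<in> X \<and> y \<in> Y")
      case True
      then have "vcomp \<psi> (under (X, a)) x y = vcomp \<psi> a (e X x) y"
        by (simp add: vcomp_def under_pair)
      also have "\<dots> \<le> vcomp b (Txi X Y \<psi>) (e X x) y" using that by (simp add: le_fun_def)
      finally show ?thesis using True by (simp add: bT)
    next
      case False
      then have "vcomp \<psi> (under (X, a)) x y = bot"
        using vcomp_in_vrel[OF under_vrel[OF A(1)] r] by (auto simp: vrel_def)
      then show ?thesis by simp
    qed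
  qed
  have F: "Tfunctor (X, a) (V_obj (Y, b)) f \<longleftrightarrow> vcomp \<psi> a \<le> vcomp b (Txi X Y \<psi>)"
  proof -
    have "(\<forall>\<xx>\<in>T X. \<forall>y\<in>Y. vcomp \<psi> a \<xx> y \<le> vcomp b (Txi X Y \<psi>) \<xx> y) \<longleftrightarrow> vcomp \<psi> a \<le> vcomp b (Txi X Y \<psi>)"
      using r1 unfolding le_fun_def vrel_def by (auto, metis bot_least)
    then show ?thesis using Tfunctor_V_obj_iff[OF A(1) B(1) f, folded \<psi>_def] by simp
  qed
  let ?eqv = "\<lambda>\<alpha> \<beta>'. map_equiv (T X) (V_obj (Y, b)) (compose (T X) \<beta>' (M X ?F f)) (compose (T X) f \<alpha>)"
  have eqv: "?eqv \<alpha>' \<beta>' \<longleftrightarrow> vcomp \<psi> a = vcomp b (Txi X Y \<psi>)"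
    if al: "repr_adjoint (X, a) \<alpha>'" and be: "repr_adjoint (V_obj (Y, b)) \<beta>'"
      and rt: "vcomp \<psi> (under (X, a)) \<le> \<psi>" for \<alpha>' \<beta>'
  proof -
    have fF': "f \<in> X \<rightarrow> ?F" using f by auto
    have Tf: "M X ?F f \<xx> \<in> T ?F" if "\<xx> \<in> T X" for \<xx>
      using Mr_in[OF SX _ fF' that] SY by (simp add: fr)
    have be': "\<beta>' \<in> T ?F \<rightarrow> ?F" using repr_adjointD(1)[OF be[unfolded V_obj_eq]] by auto
    have al': "\<alpha>' \<in> T X \<rightarrow> X" using repr_adjointD(1)[OF al] by auto
    have 1: "ev (Y, b) (\<beta>' (M X ?F f \<xx>)) y = vcomp b (Txi X Y \<psi>) \<xx> y" if "\<xx> \<in> T X" "y \<in> Y" for \<xx> y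
    proof -
      have "Txi X Y (\<lambda>x. ev (Y, b) (f x)) = Txi X Y \<psi>"
        by (rule Txi_cong) (simp add: \<psi>_def dist_of_def)
      then show ?thesis
        using repr_adjoint_V_obj_unique[OF T1 B(1) be Tf[OF that(1)]] \<mu>_Mr[OF B(1) SX fF' that(1), of y]
          ev_enc[OF SY Vfunctor_\<mu>[OF T1 B(1) Tf[OF that(1)]], of y] that
        by (simp add: fr)
    qed
    have 2: "ev (Y, b) (f (\<alpha>' \<xx>)) y = vcomp \<psi> a \<xx> y" if "\<xx> \<in> T X" for \<xx> y
      using vcomp_dist_repr[OF A(1) al r rt that] al' that by (auto simp: \<psi>_def dist_of_def)
    have "?eqv \<alpha>' \<beta>' \<longleftrightarrow> (\<forall>\<xx>\<in>T X. (\<forall>y\<in>Y. vcomp \<psi> a \<xx> y = vcomp b (Txi X Y \<psi>) \<xx> y))"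
    proof -
      have "?eqv \<alpha>' \<beta>' \<longleftrightarrow> (\<forall>\<xx>\<in>T X. (\<forall>y\<in>Y. vcomp \<psi> a \<xx> y \<le> vcomp b (Txi X Y \<psi>) \<xx> y)
          \<and> (\<forall>y\<in>Y. vcomp b (Txi X Y \<psi>) \<xx> y \<le> vcomp \<psi> a \<xx> y))"
        using Tf be' al' fF'
        by (auto simp: map_equiv_def map_le_def compose_def k_le_under_V_obj[OF B(1)] 1 2 Pi_iff)
      then show ?thesis by (auto simp: eq_iff)
    qed
    also have "\<dots> \<longleftrightarrow> vcomp \<psi> a = vcomp b (Txi X Y \<psi>)"
      using r1 unfolding fun_eq_iff vrel_def by (auto, metis)
    finally show ?thesis .
  qed
  show ?thesis
  proof
    assume "pseudo_hom (X, a) (V_obj (Y, b)) f"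
    then obtain \<alpha>' \<beta>' where *: "Tfunctor (X, a) (V_obj (Y, b)) f" "repr_adjoint (X, a) \<alpha>'"
        "repr_adjoint (V_obj (Y, b)) \<beta>'" "?eqv \<alpha>' \<beta>'"
      by (auto simp: pseudo_hom_def)
    then have rt: "vcomp \<psi> (under (X, a)) \<le> \<psi>" using F right by blast
    then show "repr_dist (X, a) (Y, b) \<psi>"
      using r left * eqv by (simp add: repr_dist_def)
  next
    assume \<psi>: "repr_dist (X, a) (Y, b) \<psi>"
    then have "vcomp \<psi> (under (X, a)) \<le> \<psi>" "vcomp \<psi> a = vcomp b (Txi X Y \<psi>)"
      by (auto simp: repr_dist_def)
    then show "pseudo_hom (X, a) (V_obj (Y, b)) f"
      using F eqv[OF A(2) repr_adjoint_V_obj[OF T1 B]] A(2) repr_adjoint_V_obj[OF T1 B]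
      by (auto simp: pseudo_hom_def)
  qed
qed

section \<open>Kleisli composition\<close>

lemma Vfunctor_under:
  assumes A: "Tcategory (X, a)" and x: "x \<in> X" and T1: "is_singleton (T one)"
  shows "Vfunctor (X, a) (under (X, a) x)"
  using T1 A A repr_dist_under[OF A] x by (rule Vfunctor_dist)

text \<open>
  This is \<open>V g(\<phi>)\<close>. If \<open>\<phi>\<close> is read as a relation from a point, then \<open>d \<cdot> T\<^sub>\<xi>(d \<cdot> T g \<cdot> \<xi> T\<phi>) \<le> d \<cdot> m \<cdot> T T g \<cdot> \<xi> T(\<xi> T\<phi>)\<close>, and
  naturality of \<open>m\<close> together with the algebra law of \<open>\<xi>\<close> bounds the right-hand side by \<open>d \<cdot> T g \<cdot> \<xi> T\<phi>\<close>.
\<close>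

lemma Vfunctor_extension:
  assumes A: "Tcategory (Y, b)" and C: "Tcategory (W, d)" and g: "g \<in> Y \<rightarrow> W"
    and \<phi>: "Vfunctor (Y, b) \<phi>"
  shows "Vfunctor (W, d) (\<lambda>w. SUP \<yy>\<in>T Y. xiT Y \<phi> \<yy> \<otimes> d (Mr Y W g \<yy>) w)"
  unfolding Vfunctor_def prod.case
proof (intro ballI)
  note SY = Tcat_small[OF A] and SW = Tcat_small[OF C]
  let ?G = "\<lambda>w. SUP \<yy>\<in>T Y. xiT Y \<phi> \<yy> \<otimes> d (Mr Y W g \<yy>) w"
  have Tg: "Mr Y W g \<in> T Y \<rightarrow> T W" using SY SW g by auto
  fix \<ww> w assume w: "\<ww> \<in> T W" "w \<in> W"
  have "xiT W ?G \<ww> \<le> (SUP \<YY>\<in>T (T Y). xiT (T Y) (xiT Y \<phi>) \<YY> \<otimes> Txi (T Y) W (\<lambda>\<yy>. d (Mr Y W g \<yy>)) \<YY> \<ww>)"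
    using SY SW w by (intro xiT_vcomp_le) auto
  then have "xiT W ?G \<ww> \<otimes> d \<ww> w
      \<le> (SUP \<YY>\<in>T (T Y). xiT (T Y) (xiT Y \<phi>) \<YY> \<otimes> Txi (T Y) W (\<lambda>\<yy>. d (Mr Y W g \<yy>)) \<YY> \<ww>) \<otimes> d \<ww> w"
    by (simp add: tensor_mono)
  also have "\<dots> \<le> ?G w"
    unfolding SUP_tensor
  proof (rule SUP_least)
    fix \<YY> assume Y: "\<YY> \<in> T (T Y)"
    let ?Z = "Mr (T Y) (T W) (Mr Y W g) \<YY>"
    have Z: "?Z \<in> T (T W)" "m W ?Z = Mr Y W g (m Y \<YY>)"
      using SY SW g Tg Y by (auto simp: m_Mr)
    have "xiT (T Y) (xiT Y \<phi>) \<YY> \<otimes> Txi (T Y) W (\<lambda>\<yy>. d (Mr Y W g \<yy>)) \<YY> \<ww> \<otimes> d \<ww> w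
        = xiT Y \<phi> (m Y \<YY>) \<otimes> (Txi (T W) W d ?Z \<ww> \<otimes> d \<ww> w)"
      using SY SW Tg Y by (simp add: xiT_m Txi_Mr assoc)
    also have "\<dots> \<le> xiT Y \<phi> (m Y \<YY>) \<otimes> d (Mr Y W g (m Y \<YY>)) w"
      using Tcat_trans[OF C Z(1), of \<ww> w] by (intro tensor_mono) (simp_all add: Z)
    also have "\<dots> \<le> ?G w" using SY Y by (intro SUP_upper) auto
    finally show "xiT (T Y) (xiT Y \<phi>) \<YY> \<otimes> Txi (T Y) W (\<lambda>\<yy>. d (Mr Y W g \<yy>)) \<YY> \<ww> \<otimes> d \<ww> w \<le> ?G w" .
  qed
  finally show "xiT W ?G \<ww> \<otimes> d \<ww> w \<le> ?G w" .
qed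

lemma SUP_Vfunctor:
  assumes A: "Tcategory (Y, b)" and \<phi>: "Vfunctor (Y, b) \<phi>" and y: "y \<in> Y"
  shows "(SUP \<yy>\<in>T Y. xiT Y \<phi> \<yy> \<otimes> b \<yy> y) = \<phi> y"
proof (rule antisym)
  note S = Tcat_small[OF A]
  show "(SUP \<yy>\<in>T Y. xiT Y \<phi> \<yy> \<otimes> b \<yy> y) \<le> \<phi> y"
    using Vfunctor_le[OF \<phi> _ y] by (intro SUP_least)
  have "\<phi> y \<le> xiT Y \<phi> (e Y y) \<otimes> b (e Y y) y"
    using k_tensor_le(2)[OF Tcat_refl[OF A y], of "\<phi> y"] S y by (simp add: xiT_e)
  also have "\<dots> \<le> (SUP \<yy>\<in>T Y. xiT Y \<phi> \<yy> \<otimes> b \<yy> y)"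
    using S y by (intro SUP_upper) auto
  finally show "\<phi> y \<le> (SUP \<yy>\<in>T Y. xiT Y \<phi> \<yy> \<otimes> b \<yy> y)" .
qed

text \<open>
  The Yoneda lemma for \<open>V X\<close>: \<open>[a\<^sub>0(x, -), \<mu>(\<pp>)] = \<mu>(\<pp>, x)\<close>, because \<open>a\<^sub>0\<close> is reflexive and \<open>a\<^sub>0 \<cdot> \<mu> = \<mu>\<close>.
\<close>

lemma Vstr_unit:
  assumes T1: "is_singleton (T one)" and A: "Tcategory (X, a)" and p: "\<pp> \<in> T (funs (X, a))" and x: "x \<in> X"
  shows "Vstr (X, a) \<pp> (enc X (under (X, a) x)) = \<mu> (X, a) \<pp> x"
proof (rule antisym)
  note S = Tcat_small[OF A] and V = Vfunctor_under[OF A x T1]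
  let ?h = "enc X (under (X, a) x)"
  have h: "?h \<in> funs (X, a)" using S V by (rule enc_in_funs)
  have ev: "ev (X, a) ?h y = under (X, a) x y" if "y \<in> X" for y
    using that by (simp add: ev_enc[OF S V])
  have "Vstr (X, a) \<pp> ?h \<le> Vstr (X, a) \<pp> ?h \<otimes> under (X, a) x x"
    using under_refl[OF A x] by (rule k_tensor_le)
  also have "\<dots> \<le> \<mu> (X, a) \<pp> x"
    using le_Vstr_iff[OF p h, of "Vstr (X, a) \<pp> ?h"] x by (simp add: ev)
  finally show "Vstr (X, a) \<pp> ?h \<le> \<mu> (X, a) \<pp> x" .
  have "\<mu> (X, a) \<pp> x \<otimes> under (X, a) x y \<le> \<mu> (X, a) \<pp> y" for y
  proof -
    have "\<mu> (X, a) \<pp> x \<otimes> under (X, a) x y \<le> vcomp (under (X, a)) (\<mu> (X, a)) \<pp> y"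
      by (rule vcomp_upper)
    also have "\<dots> = \<mu> (X, a) \<pp> y" by (simp add: \<mu>_pair vcomp_assoc vcomp_under[OF A])
    finally show ?thesis .
  qed
  then show "\<mu> (X, a) \<pp> x \<le> Vstr (X, a) \<pp> ?h"
    using le_Vstr_iff[OF p h] by (simp add: ev)
qed

text \<open>
  Let \<open>\<phi>\<close> be the functor \<open>p\<close> and \<open>\<psi>\<close> the mate of \<open>g\<close>. Evaluating \<open>V g(\<phi>)\<close> at the representable functor of
  \<open>z\<close> gives \<open>\<Squnion>\<^sub>\<yy> \<xi> T\<phi>(\<yy>) \<otimes> \<mu>(T g(\<yy>), z)\<close> by \<open>Vstr_unit\<close>. Here \<open>\<mu> \<cdot> T g = c \<cdot> T\<^sub>\<xi> \<psi> = \<psi> \<cdot> b\<close>, and the supremum over \<open>\<yy>\<close>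
  collapses to \<open>\<phi>\<close> by \<open>SUP_Vfunctor\<close>.
\<close>

lemma kleisli_comp_value:
  assumes T1: "is_singleton (T one)" and B: "Tcategory (Y, b)" and C: "Tcategory (Z, c)"
    and p: "p \<in> funs (Y, b)" and g: "g \<in> Y \<rightarrow>\<^sub>E funs (Z, c)"
    and eq: "vcomp (dist_of (Y, b) (Z, c) g) b = vcomp c (Txi Y Z (dist_of (Y, b) (Z, c) g))"
  shows "V_mult (Z, c) (V_map (Y, b) (V_obj (Z, c)) g p)
    = enc Z (\<lambda>z. SUP y. ev (Y, b) p y \<otimes> dist_of (Y, b) (Z, c) g y z)"
proof -
  note SY = Tcat_small[OF B] and SZ = Tcat_small[OF C]
  let ?F = "funs (Z, c)" and ?c = "Vstr (Z, c)"
  let ?\<phi> = "ev (Y, b) p" and ?\<psi> = "dist_of (Y, b) (Z, c) g"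
  let ?G = "\<lambda>\<zeta>. SUP \<yy>\<in>T Y. xiT Y ?\<phi> \<yy> \<otimes> ?c (Mr Y ?F g \<yy>) \<zeta>"
  have VC: "Tcategory (?F, ?c)" using Tcategory_V_obj[OF C] by (simp add: V_obj_eq)
  have SF: "small ?F" using SZ by simp
  have gF: "g \<in> Y \<rightarrow> ?F" and gr: "restrict g Y = g" using g by (auto simp: PiE_restrict)
  have V\<phi>: "Vfunctor (Y, b) ?\<phi>" using SY p by (rule Vfunctor_ev)
  have "fapply Y p = (\<lambda>y\<in>Y. cd (?\<phi> y))"
    using fapply_enc[OF SY, of ?\<phi>] enc_ev[OF SY p] by simp
  then have "V_map (Y, b) (V_obj (Z, c)) g p = enc ?F ?G"
    using p by (simp add: V_map_def V_obj_eq enc_def xiT_def gr)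
  moreover have "enc ?F ?G \<in> funs (?F, ?c)"
    using SF Vfunctor_extension[OF B VC gF V\<phi>] by (rule enc_in_funs)
  moreover have "fapply ?F (enc ?F ?G) (V_unit (Z, c) z) = cd (SUP y. ?\<phi> y \<otimes> ?\<psi> y z)"
    if z: "z \<in> Z" for z
  proof -
    have h: "V_unit (Z, c) z = enc Z (under (Z, c) z)"
      using z by (simp add: V_unit_def enc_def)
    have hF: "enc Z (under (Z, c) z) \<in> ?F"
      using SZ Vfunctor_under[OF C z T1] by (rule enc_in_funs)
    have T\<psi>: "Txi Y Z (\<lambda>y. ev (Z, c) (g y)) = Txi Y Z ?\<psi>"
      by (rule Txi_cong) (simp add: dist_of_def)
    have "?G (enc Z (under (Z, c) z)) = (SUP \<yy>\<in>T Y. xiT Y ?\<phi> \<yy> \<otimes> vcomp ?\<psi> b \<yy> z)"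
    proof (rule SUP_cong[OF refl])
      fix \<yy> assume y: "\<yy> \<in> T Y"
      have "?c (Mr Y ?F g \<yy>) (enc Z (under (Z, c) z)) = \<mu> (Z, c) (Mr Y ?F g \<yy>) z"
        using SY SF gF y z by (intro Vstr_unit[OF T1 C]) auto
      also have "\<dots> = vcomp ?\<psi> b \<yy> z"
        using \<mu>_Mr[OF C SY gF y] by (simp add: T\<psi> eq)
      finally show "xiT Y ?\<phi> \<yy> \<otimes> ?c (Mr Y ?F g \<yy>) (enc Z (under (Z, c) z))
        = xiT Y ?\<phi> \<yy> \<otimes> vcomp ?\<psi> b \<yy> z" by simp
    qed
    also have "\<dots> = (SUP \<yy>\<in>T Y. SUP y. (xiT Y ?\<phi> \<yy> \<otimes> b \<yy> y) \<otimes> ?\<psi> y z)"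
      by (simp add: vcomp_def tensor_SUP assoc)
    also have "\<dots> = (SUP y. SUP \<yy>\<in>T Y. (xiT Y ?\<phi> \<yy> \<otimes> b \<yy> y) \<otimes> ?\<psi> y z)"
      by (rule SUP_commute)
    also have "\<dots> = (SUP y. ?\<phi> y \<otimes> ?\<psi> y z)"
    proof (rule SUP_cong[OF refl])
      fix y
      show "(SUP \<yy>\<in>T Y. (xiT Y ?\<phi> \<yy> \<otimes> b \<yy> y) \<otimes> ?\<psi> y z) = ?\<phi> y \<otimes> ?\<psi> y z"
      proof (cases "y \<in> Y")
        case True
        then show ?thesis using SUP_Vfunctor[OF B V\<phi> True] by (simp flip: SUP_tensor)
      next
        case False
        then show ?thesis by (simp add: dist_of_def)
      qed
    qed
    finally show ?thesis using hF by (simp add: h fapply_enc[OF SF])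
  qed
  ultimately show ?thesis by (simp add: V_mult_def V_obj_eq enc_def cong: restrict_cong)
qed

section \<open>The equivalence\<close>

theorem ReprCat_V_equivalent_ReprDist:
  assumes T1: "is_singleton (T one)"
  shows "equivalent_categories ReprCat_V ReprDist"
proof (rule equivalent_categoriesI[where \<Phi> = dist_of and \<Psi> = map_of_dist])
  have Obj: "Obj ReprDist = {A. representable A}" "Obj ReprCat_V = {A. representable A}"
    and Hom: "Hom ReprDist = (\<lambda>A B. {\<psi>. repr_dist A B \<psi>})"
      "Hom ReprCat_V = (\<lambda>A B. {f. pseudo_hom A (V_obj B) f})"
    and Ident: "Ident ReprDist = under" "Ident ReprCat_V = V_unit"
    and Comp: "Comp ReprDist = (\<lambda>A B C s r. vcomp s r)"
      "Comp ReprCat_V = (\<lambda>A B C g f. compose (fst A) (V_mult C) (compose (fst A) (V_map B (V_obj C) g) f))"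
    by (simp_all add: ReprDist_def ReprCat_V_def kleisli_def ReprCat_def)
  show "category ReprDist" by (rule category_ReprDist)
  show "Obj ReprCat_V = Obj ReprDist" by (simp add: Obj)
  have hom_dist: "dist_of A B f \<in> Hom ReprDist A B \<and> map_of_dist A B (dist_of A B f) = f"
    if "A \<in> Obj ReprDist" "B \<in> Obj ReprDist" "f \<in> Hom ReprCat_V A B" for A B f
  proof -
    from that have "representable A" "representable B" by (simp_all add: Obj)
    then obtain X a \<alpha> Y b \<beta> where
      A: "A = (X, a)" "Tcategory (X, a)" "repr_adjoint (X, a) \<alpha>" and
      B: "B = (Y, b)" "Tcategory (Y, b)" "repr_adjoint (Y, b) \<beta>"
      by (elim representableE)
    have ph: "pseudo_hom (X, a) (V_obj (Y, b)) f" using that(3) by (simp add: Hom A(1) B(1))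
    then have f: "f \<in> X \<rightarrow>\<^sub>E funs (Y, b)" by (simp add: pseudo_hom_def Tfunctor_iff)
    show ?thesis
      using ph pseudo_hom_V_obj_iff[OF T1 A(2,3) B(2,3) f] map_of_dist_of[OF Tcat_small[OF B(2)] f]
      by (simp add: Hom A(1) B(1))
  qed
  have dist_hom: "map_of_dist A B \<psi> \<in> Hom ReprCat_V A B \<and> dist_of A B (map_of_dist A B \<psi>) = \<psi>"
    if "A \<in> Obj ReprDist" "B \<in> Obj ReprDist" "\<psi> \<in> Hom ReprDist A B" for A B \<psi>
  proof -
    from that have "representable A" "representable B" by (simp_all add: Obj)
    then obtain X a \<alpha> Y b \<beta> where
      A: "A = (X, a)" "Tcategory (X, a)" "repr_adjoint (X, a) \<alpha>" and
      B: "B = (Y, b)" "Tcategory (Y, b)" "repr_adjoint (Y, b) \<beta>"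
      by (elim representableE)
    have rd: "repr_dist (X, a) (Y, b) \<psi>" using that(3) by (simp add: Hom A(1) B(1))
    note V = Vfunctor_dist[OF T1 A(2) B(2) rd]
    have eq: "dist_of (X, a) (Y, b) (map_of_dist (X, a) (Y, b) \<psi>) = \<psi>"
      using rd by (intro dist_of_map_of_dist V Tcat_small[OF B(2)]) (simp add: repr_dist_def)
    have "map_of_dist (X, a) (Y, b) \<psi> \<in> X \<rightarrow>\<^sub>E funs (Y, b)"
      using enc_in_funs[OF Tcat_small[OF B(2)] V] by (simp add: map_of_dist_def)
    then show ?thesis
      using rd eq pseudo_hom_V_obj_iff[OF T1 A(2,3) B(2,3)] by (simp add: Hom A(1) B(1))
  qed
  show "dist_of A B f \<in> Hom ReprDist A B" "map_of_dist A B (dist_of A B f) = f"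
    if "A \<in> Obj ReprDist" "B \<in> Obj ReprDist" "f \<in> Hom ReprCat_V A B" for A B f
    using hom_dist[OF that] by blast+
  show "map_of_dist A B \<psi> \<in> Hom ReprCat_V A B" "dist_of A B (map_of_dist A B \<psi>) = \<psi>"
    if "A \<in> Obj ReprDist" "B \<in> Obj ReprDist" "\<psi> \<in> Hom ReprDist A B" for A B \<psi>
    using dist_hom[OF that] by blast+
  show "Ident ReprCat_V A = map_of_dist A A (Ident ReprDist A)" for A
    by (simp add: Ident V_unit_def map_of_dist_def enc_def)
  show "Comp ReprCat_V A B C g f = map_of_dist A C (Comp ReprDist A B C (dist_of B C g) (dist_of A B f))"
    if "A \<in> Obj ReprDist" "B \<in> Obj ReprDist" "C \<in> Obj ReprDist"
      "f \<in> Hom ReprCat_V A B" "g \<in> Hom ReprCat_V B C" for A B C f g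
  proof -
    from that have "representable B" "representable C" by (simp_all add: Obj)
    then obtain Y b \<beta> Z c \<gamma> where
      B: "B = (Y, b)" "Tcategory (Y, b)" "repr_adjoint (Y, b) \<beta>" and
      C: "C = (Z, c)" "Tcategory (Z, c)" "repr_adjoint (Z, c) \<gamma>"
      by (elim representableE)
    obtain X a where A: "A = (X, a)" by (cases A)
    have f: "f \<in> X \<rightarrow>\<^sub>E funs (Y, b)" and g: "g \<in> Y \<rightarrow>\<^sub>E funs (Z, c)"
      using that(4,5) by (simp_all add: Hom A B C pseudo_hom_def Tfunctor_iff)
    have "repr_dist (Y, b) (Z, c) (dist_of (Y, b) (Z, c) g)"
      using hom_dist[OF that(2,3,5)] by (simp add: Hom B C)
    then have eq: "vcomp (dist_of (Y, b) (Z, c) g) b = vcomp c (Txi Y Z (dist_of (Y, b) (Z, c) g))"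
      by (simp add: repr_dist_def)
    have "V_mult (Z, c) (V_map (Y, b) (V_obj (Z, c)) g (f x))
        = enc Z (vcomp (dist_of (Y, b) (Z, c) g) (dist_of (X, a) (Y, b) f) x)" if "x \<in> X" for x
      using kleisli_comp_value[OF T1 B(2) C(2) _ g eq, of "f x"] f that
      by (auto simp: vcomp_def dist_of_def)
    then show ?thesis
      by (auto simp: Comp A B(1) C(1) compose_def map_of_dist_def fun_eq_iff)
  qed
qed

end

theorem theorem8p5:
  fixes elts :: "'u \<Rightarrow> 'u set"
    and T :: "'u set \<Rightarrow> 'u set"
    and M :: "'u set \<Rightarrow> 'u set \<Rightarrow> ('u \<Rightarrow> 'u) \<Rightarrow> 'u \<Rightarrow> 'u"
    and e :: "'u set \<Rightarrow> 'u \<Rightarrow> 'u"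
    and m :: "'u set \<Rightarrow> 'u \<Rightarrow> 'u"
    and tensor :: "'v::complete_lattice \<Rightarrow> 'v \<Rightarrow> 'v"
    and k :: 'v
    and \<xi> :: "'u \<Rightarrow> 'v"
    and cd :: "'v \<Rightarrow> 'u"
  assumes "topological_theory elts T M e m tensor k \<xi> cd"
    and "bot \<noteq> k"
    and "is_singleton (T (universe.one elts))"
  shows "equivalent_categories
    (topological_theory.ReprCat_V elts T M e m tensor k \<xi> cd)
    (topological_theory.ReprDist elts T M e m tensor k \<xi> cd)"
  using assms(1,3) by (rule topological_theory.ReprCat_V_equivalent_ReprDist)

end
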